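(* Let $\alpha\in(0,1)$, let $\epsilon>0$, and let $(\epsilon_n)_{n\in\mathbb{N}}$ be a non-decreasing sequence with $0\le \epsilon_n<\epsilon$ for all $n$ and $\epsilon_n\to\epsilon$. Let $(U_n)$, $(L_n)$ be the boundaries recursively constructed from $\alpha$ and $(\epsilon_n)$, let $\tau$ be the associated stopping time and let $\hat p$ be the associated estimator, as defined in the context. Suppose that $\epsilon\le 1/4$ and $\log(\epsilon_n-\epsilon_{n-1})=o(n)$ as $n\to\infty$. Then $$\sup_{p\in[0,1]}\mathrm{RR}_p(\hat p)\le\epsilon.$$
   Context: Notation: $\mathbb{N}=\{1,2,\dots\}$. For $p\in[0,1]$, under $\mathrm{P}_p$ the random variables $X_1,X_2,\dots$ are independent and identically Bernoulli distributed with parameter $p$, and $S_n=\sum_{i=1}^n X_i$. Given integer sequences $(U_n)_{n\in\mathbb{N}}$, $(L_n)_{n\in\mathbb{N}}$, the stopping time is $$\tau=\inf\{k\in\mathbb{N}: S_k\ge U_k \text{ or } S_k\le L_k\}\qquad(\inf\emptyset=\infty).$$ Construction of the boundaries from the threshold $\alpha$ and the spending sequence $(\epsilon_n)$: set $U_1=2$, $L_1=-1$ and, recursively for $n\in\{2,3,\dots\}$, $$U_n=\min\{j\in\mathbb{N}: \mathrm{P}_\alpha(\tau\ge n,\ S_n\ge j)+\mathrm{P}_\alpha(\tau<n,\ S_\tau\ge U_\tau)\le\epsilon_n\},$$ $$L_n=\max\{j\in\mathbb{Z}: \mathrm{P}_\alpha(\tau\ge n,\ S_n\le j)+\mathrm{P}_\alpha(\tau<n,\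 S_\tau\le L_\tau)\le\epsilon_n\}.$$ The events $\{\tau\ge n\}$ and $\{\tau<n\}$ and the value of $S_\tau$ on $\{\tau<n\}$ depend only on $U_1,\dots,U_{n-1}$ and $L_1,\dots,L_{n-1}$, so the recursion makes sense. Estimator: $\hat p=S_\tau/\tau$ if $\tau<\infty$, and $\hat p=\alpha$ if $\tau=\infty$. Resampling risk (with respect to the threshold $\alpha$): $\mathrm{RR}_p(\hat p)=\mathrm{P}_p(\hat p>\alpha)$ if $p\le\alpha$, and $\mathrm{RR}_p(\hat p)=\mathrm{P}_p(\hat p\le\alpha)$ if $p>\alpha$. Convention: $\log 0=-\infty$, so the condition $\log(\epsilon_n-\epsilon_{n-1})=o(n)$ includes that $\epsilon_n>\epsilon_{n-1}$ for all sufficiently large $n$. *)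

theory Defs
  imports "HOL-Probability.Probability" "HOL-Library.Landau_Symbols"
begin

text \<open>Sequences are indexed by the positive integers; values at index \<open>0\<close> are irrelevant.\<close>

definition bernoulli_process :: "'a measure \<Rightarrow> (nat \<Rightarrow> 'a \<Rightarrow> bool) \<Rightarrow> real \<Rightarrow> bool" where
  "bernoulli_process M X p \<longleftrightarrow>
     prob_space M \<and>
     prob_space.indep_vars M (\<lambda>_. count_space UNIV) X {1..} \<and>
     (\<forall>i\<ge>1. distr M (count_space UNIV) (X i) = measure_pmf (bernoulli_pmf p))"

definition partial_sum :: "(nat \<Rightarrow> 'a \<Rightarrow> bool) \<Rightarrow> nat \<Rightarrow> 'a \<Rightarrow> int" where
  "partial_sum X n \<omega> = (\<Sum>i=1..n. of_bool (X i \<omega>))"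

definition hit_time :: "(nat \<Rightarrow> int) \<Rightarrow> (nat \<Rightarrow> int) \<Rightarrow> (nat \<Rightarrow> 'a \<Rightarrow> bool) \<Rightarrow> 'a \<Rightarrow> enat" where
  "hit_time U L X \<omega> =
     Inf {enat k | k. k \<ge> 1 \<and> (partial_sum X k \<omega> \<ge> U k \<or> partial_sum X k \<omega> \<le> L k)}"

definition upper_spent ::
  "'a measure \<Rightarrow> (nat \<Rightarrow> 'a \<Rightarrow> bool) \<Rightarrow> (nat \<Rightarrow> int) \<Rightarrow> (nat \<Rightarrow> int) \<Rightarrow> nat \<Rightarrow> int \<Rightarrow> real" where
  "upper_spent M X U L n j =
     measure M {\<omega> \<in> space M. hit_time U L X \<omega> \<ge> enat n \<and> partial_sum X n \<omega> \<ge> j} +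
     measure M {\<omega> \<in> space M. hit_time U L X \<omega> < enat n \<and>
       partial_sum X (the_enat (hit_time U L X \<omega>)) \<omega> \<ge> U (the_enat (hit_time U L X \<omega>))}"

definition lower_spent ::
  "'a measure \<Rightarrow> (nat \<Rightarrow> 'a \<Rightarrow> bool) \<Rightarrow> (nat \<Rightarrow> int) \<Rightarrow> (nat \<Rightarrow> int) \<Rightarrow> nat \<Rightarrow> int \<Rightarrow> real" where
  "lower_spent M X U L n j =
     measure M {\<omega> \<in> space M. hit_time U L X \<omega> \<ge> enat n \<and> partial_sum X n \<omega> \<le> j} +
     measure M {\<omega> \<in> space M. hit_time U L X \<omega> < enat n \<and>
       partial_sum X (the_enat (hit_time U L X \<omega>)) \<omega> \<le> L (the_enat (hit_time U L X \<omega>))}"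

text \<open>
  \<open>boundaries_upto M X e m\<close> is a pair \<open>(U, L)\<close> whose values at \<open>1, \<dots>, m + 1\<close> are the
  constructed boundaries; later values are placeholders. They do not influence the spent
  probabilities at step \<open>m + 2\<close>, so the boundaries satisfy the intended recursion with the full
  sequences on the right-hand side: see \<open>upper_boundary_rec\<close> and \<open>lower_boundary_rec\<close> below.
\<close>

primrec boundaries_upto ::
  "'a measure \<Rightarrow> (nat \<Rightarrow> 'a \<Rightarrow> bool) \<Rightarrow> (nat \<Rightarrow> real) \<Rightarrow> nat \<Rightarrow> (nat \<Rightarrow> int) \<times> (nat \<Rightarrow> int)" where
  "boundaries_upto M X e 0 = ((\<lambda>_. 2), (\<lambda>_. - 1))"
| "boundaries_upto M X e (Suc m) =
     (let (U, L) = boundaries_upto M X e m; n = m + 2 in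
       (U(n := (LEAST j. j \<ge> 1 \<and> upper_spent M X U L n j \<le> e n)),
        L(n := (GREATEST j. lower_spent M X U L n j \<le> e n))))"

definition upper_boundary ::
  "'a measure \<Rightarrow> (nat \<Rightarrow> 'a \<Rightarrow> bool) \<Rightarrow> (nat \<Rightarrow> real) \<Rightarrow> nat \<Rightarrow> int" where
  "upper_boundary M X e n = fst (boundaries_upto M X e (n - 1)) n"

definition lower_boundary ::
  "'a measure \<Rightarrow> (nat \<Rightarrow> 'a \<Rightarrow> bool) \<Rightarrow> (nat \<Rightarrow> real) \<Rightarrow> nat \<Rightarrow> int" where
  "lower_boundary M X e n = snd (boundaries_upto M X e (n - 1)) n"

definition p_hat ::
  "real \<Rightarrow> (nat \<Rightarrow> int) \<Rightarrow> (nat \<Rightarrow> int) \<Rightarrow> (nat \<Rightarrow> 'a \<Rightarrow> bool) \<Rightarrow> 'a \<Rightarrow> real" where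
  "p_hat \<alpha> U L X \<omega> =
     (case hit_time U L X \<omega> of
        enat k \<Rightarrow> real_of_int (partial_sum X k \<omega>) / real k
      | \<infinity> \<Rightarrow> \<alpha>)"

definition resampling_risk :: "(real \<Rightarrow> 'a measure) \<Rightarrow> real \<Rightarrow> ('a \<Rightarrow> real) \<Rightarrow> real \<Rightarrow> real" where
  "resampling_risk P \<alpha> q p =
     (if p \<le> \<alpha> then measure (P p) {\<omega> \<in> space (P p). q \<omega> > \<alpha>}
      else measure (P p) {\<omega> \<in> space (P p). q \<omega> \<le> \<alpha>})"

lemma hit_time_less_iff:
  "hit_time U L X \<omega> < enat n \<longleftrightarrow>
     (\<exists>k. 1 \<le> k \<and> k < n \<and> (partial_sum X k \<omega> \<ge> U k \<or> partial_sum X k \<omega> \<le> L k))"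
  unfolding hit_time_def Inf_less_iff by auto

lemma hit_time_less_cong:
  assumes "\<And>k. 1 \<le> k \<Longrightarrow> k < n \<Longrightarrow> U k = U' k" "\<And>k. 1 \<le> k \<Longrightarrow> k < n \<Longrightarrow> L k = L' k" "m \<le> n"
  shows "hit_time U L X \<omega> < enat m \<longleftrightarrow> hit_time U' L' X \<omega> < enat m"
  unfolding hit_time_less_iff using assms by (metis order_less_le_trans)

lemma hit_time_cong:
  assumes "\<And>k. 1 \<le> k \<Longrightarrow> k < n \<Longrightarrow> U k = U' k" "\<And>k. 1 \<le> k \<Longrightarrow> k < n \<Longrightarrow> L k = L' k"
    and "hit_time U L X \<omega> < enat n"
  shows "hit_time U' L' X \<omega> = hit_time U L X \<omega>"
proof -
  note c = hit_time_less_cong[of n U U' L L', OF assms(1,2)]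
  obtain a where a: "hit_time U L X \<omega> = enat a" "a < n"
    using assms(3) by (cases "hit_time U L X \<omega>") auto
  obtain b where b: "hit_time U' L' X \<omega> = enat b" "b < n"
    using assms(3) c[of n X \<omega>] by (cases "hit_time U' L' X \<omega>") auto
  have "a < Suc b" "b < Suc a"
    using c[of "Suc b" X \<omega>] c[of "Suc a" X \<omega>] a b by auto
  then show ?thesis using a b by simp
qed

lemma hit_time_pos: "hit_time U L X \<omega> = enat k \<Longrightarrow> 1 \<le> k"
  using hit_time_less_iff[of U L X \<omega> 1] by (cases k) (auto simp: zero_enat_def one_enat_def)

lemma spent_cong:
  assumes "\<And>k. 1 \<le> k \<Longrightarrow> k < n \<Longrightarrow> U k = U' k" "\<And>k. 1 \<le> k \<Longrightarrow> k < n \<Longrightarrow> L k = L' k"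
  shows "upper_spent M X U L n j = upper_spent M X U' L' n j"
    and "lower_spent M X U L n j = lower_spent M X U' L' n j"
proof -
  have 1: "hit_time U L X \<omega> \<ge> enat n \<longleftrightarrow> hit_time U' L' X \<omega> \<ge> enat n" for \<omega>
    using hit_time_less_cong[of n U U' L L' n X \<omega>] assms by (auto simp: not_less[symmetric])
  have 2: "hit_time U L X \<omega> < enat n \<and> P (the_enat (hit_time U L X \<omega>)) \<longleftrightarrow>
      hit_time U' L' X \<omega> < enat n \<and> P' (the_enat (hit_time U' L' X \<omega>))"
    if "\<And>k. 1 \<le> k \<Longrightarrow> k < n \<Longrightarrow> P k \<longleftrightarrow> P' k" for \<omega> P P'
  proof (cases "hit_time U L X \<omega> < enat n")
    case True
    then have e: "hit_time U' L' X \<omega> = hit_time U L X \<omega>"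
      by (intro hit_time_cong[where n = n] assms)
    obtain a where "hit_time U L X \<omega> = enat a" "a < n"
      using True by (cases "hit_time U L X \<omega>") auto
    with e that[of a] hit_time_pos[of U L X \<omega> a] show ?thesis by auto
  next
    case False
    then show ?thesis using 1[of \<omega>] by (auto simp: not_less[symmetric])
  qed
  have u: "(hit_time U L X \<omega> < enat n \<and> partial_sum X (the_enat (hit_time U L X \<omega>)) \<omega> \<ge> U (the_enat (hit_time U L X \<omega>))) \<longleftrightarrow>
    (hit_time U' L' X \<omega> < enat n \<and> partial_sum X (the_enat (hit_time U' L' X \<omega>)) \<omega> \<ge> U' (the_enat (hit_time U' L' X \<omega>)))" for \<omega>
    by (rule 2[of "\<lambda>k. partial_sum X k \<omega> \<ge> U k" "\<lambda>k. partial_sum X k \<omega> \<ge> U' k"]) (simp add: assms)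
  have l: "(hit_time U L X \<omega> < enat n \<and> partial_sum X (the_enat (hit_time U L X \<omega>)) \<omega> \<le> L (the_enat (hit_time U L X \<omega>))) \<longleftrightarrow>
    (hit_time U' L' X \<omega> < enat n \<and> partial_sum X (the_enat (hit_time U' L' X \<omega>)) \<omega> \<le> L' (the_enat (hit_time U' L' X \<omega>)))" for \<omega>
    by (rule 2[of "\<lambda>k. partial_sum X k \<omega> \<le> L k" "\<lambda>k. partial_sum X k \<omega> \<le> L' k"]) (simp add: assms)
  show "upper_spent M X U L n j = upper_spent M X U' L' n j"
    unfolding upper_spent_def 1 u ..
  show "lower_spent M X U L n j = lower_spent M X U' L' n j"
    unfolding lower_spent_def 1 l ..
qed

lemma boundaries_upto_stable:
  assumes "k \<le> Suc m" "m \<le> m'"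
  shows "fst (boundaries_upto M X e m') k = fst (boundaries_upto M X e m) k"
    and "snd (boundaries_upto M X e m') k = snd (boundaries_upto M X e m) k"
  using assms(2,1) by (induction m' rule: dec_induct) (auto simp: Let_def split: prod.splits)

lemma boundaries_upto_eq:
  assumes "1 \<le> k" "k \<le> Suc m"
  shows "fst (boundaries_upto M X e m) k = upper_boundary M X e k"
    and "snd (boundaries_upto M X e m) k = lower_boundary M X e k"
  unfolding upper_boundary_def lower_boundary_def
  using assms by (auto intro!: boundaries_upto_stable)

lemma boundary_1: "upper_boundary M X e 1 = 2" "lower_boundary M X e 1 = - 1"
  by (simp_all add: upper_boundary_def lower_boundary_def)

lemma boundary_rec_aux:
  assumes "n \<ge> 2"
  shows "upper_boundary M X e n =
      (LEAST j. j \<ge> 1 \<and> upper_spent M X (upper_boundary M X e) (lower_boundary M X e) n j \<le> e n) \<and>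
    lower_boundary M X e n =
      (GREATEST j. lower_spent M X (upper_boundary M X e) (lower_boundary M X e) n j \<le> e n)"
proof -
  obtain m where n: "n = m + 2" using assms by (metis add.commute le_Suc_ex)
  obtain U L where UL: "boundaries_upto M X e m = (U, L)" by force
  have a: "U k = upper_boundary M X e k" "L k = lower_boundary M X e k" if "1 \<le> k" "k < n" for k
    using boundaries_upto_eq[of k m M X e] that UL n by auto
  have s: "upper_spent M X U L n j = upper_spent M X (upper_boundary M X e) (lower_boundary M X e) n j"
    "lower_spent M X U L n j = lower_spent M X (upper_boundary M X e) (lower_boundary M X e) n j" for j
    by (intro spent_cong a; assumption)+
  have "upper_boundary M X e n = (LEAST j. j \<ge> 1 \<and> upper_spent M X U L n j \<le> e n)"
    "lower_boundary M X e n = (GREATEST j. lower_spent M X U L n j \<le> e n)"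
    using UL n by (simp_all add: upper_boundary_def lower_boundary_def)
  then show ?thesis unfolding s by simp
qed

lemmas upper_boundary_rec = boundary_rec_aux[THEN conjunct1]
  and lower_boundary_rec = boundary_rec_aux[THEN conjunct2]

end

theory Submission
  imports Defs
begin

text \<open>
  The events of meeting the upper, respectively lower, boundary first are monotone in the path, so
  by coupling their probabilities under \<open>p \<le> \<alpha>\<close>, respectively \<open>p \<ge> \<alpha>\<close>, are at most those under
  \<open>\<alpha>\<close>, which the construction keeps below \<open>\<epsilon>\<close>. It remains to see that the estimator lies on the
  side of \<open>\<alpha>\<close> indicated by the boundary that was met, and that for \<open>p > \<alpha>\<close> some boundary is met
  almost surely.

  For the former, under \<open>\<alpha>\<close> the event \<open>S\<^sub>n \<ge> U\<^sub>n\<close> is covered by the spent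
  probabilities of both boundaries, so its probability is at most \<open>2 \<epsilon>\<^sub>n < 1/2\<close>; as the median of a
  binomial distribution lies between the floor and the ceiling of its mean, \<open>U\<^sub>n > n \<alpha>\<close>, and
  symmetrically \<open>L\<^sub>n < n \<alpha>\<close>. For the latter, Hoeffding's inequality and the growth condition on
  \<open>\<epsilon>\<^sub>n - \<epsilon>\<^bsub>n-1\<^esub>\<close> give \<open>U\<^sub>n \<le> \<lceil>n (\<alpha> + \<delta>)\<rceil>\<close> eventually, which a path with \<open>p > \<alpha> + \<delta>\<close> exceeds.
\<close>

section \<open>The binomial median\<close>

text \<open>Each term \<open>(real j - real c) * d j\<close> is non-negative since both factors
  change sign at \<open>c\<close>; their sum is the assumed moment minus
  \<open>real c + 1 / 2\<close> times the plain sum. The weight \<open>real j + 1 / 2\<close> is the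
  later distance of \<open>a - j\<close> and \<open>a + 1 + j\<close> from the midpoint
  \<open>a + 1 / 2\<close>.\<close>

lemma sum_nonpos_of_single_crossing:
  fixes d :: "nat \<Rightarrow> real"
  assumes "\<And>j. j < c \<Longrightarrow> d j \<le> 0" "\<And>j. c \<le> j \<Longrightarrow> 0 \<le> d j"
    and "(\<Sum>j\<le>N. (real j + 1 / 2) * d j) \<le> 0"
  shows "(\<Sum>j\<le>N. d j) \<le> 0"
proof -
  have "0 \<le> (\<Sum>j\<le>N. (real j - real c) * d j)"
  proof (rule sum_nonneg)
    fix j show "0 \<le> (real j - real c) * d j"
      using assms(1,2)[of j] by (cases "j < c") (auto intro: mult_nonneg_nonneg mult_nonpos_nonpos)
  qed
  also have "\<dots> = (\<Sum>j\<le>N. (real j + 1 / 2) * d j) - (real c + 1 / 2) * (\<Sum>j\<le>N. d j)"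
    unfolding sum_distrib_left sum_subtractf[symmetric] by (simp add: algebra_simps)
  finally have "(real c + 1 / 2) * (\<Sum>j\<le>N. d j) \<le> 0" using assms(3) by linarith
  then show ?thesis by (simp add: mult_le_0_iff)
qed

text \<open>Up to the factor \<open>(a + b) ^ (a + b)\<close>, these are the weights of the binomial distribution
  with \<open>a + b\<close> trials and mean \<open>a\<close>.\<close>

definition binom_weight :: "nat \<Rightarrow> nat \<Rightarrow> nat \<Rightarrow> real" where
  "binom_weight a b i = real ((a + b) choose i) * real a ^ i * real b ^ (a + b - i)"

lemma binom_weight_nonneg: "0 \<le> binom_weight a b i"
  by (simp add: binom_weight_def)

lemma binom_weight_eq_0: "a + b < i \<Longrightarrow> binom_weight a b i = 0"
  by (simp add: binom_weight_def)

text \<open>The ratio of consecutive weights, cross-multiplied so that it survives past the last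
  index and for \<open>b = 0\<close>.\<close>

lemma binom_weight_Suc:
  "binom_weight a b (Suc i) * (real i + 1) * real b
   = binom_weight a b i * (real a + real b - real i) * real a"
proof (cases "i < a + b")
  case True
  have "real (Suc i * ((a + b) choose Suc i)) = real ((a + b - i) * ((a + b) choose i))"
    by (metis binomial_absorb_comp binomial_absorption)
  moreover have "real (a + b - i) = real a + real b - real i" using True by (simp add: of_nat_diff)
  ultimately have 1: "(real i + 1) * real ((a + b) choose Suc i)
      = (real a + real b - real i) * real ((a + b) choose i)"
    by (simp only: of_nat_mult of_nat_Suc) (simp add: algebra_simps)
  have "a + b - i = Suc (a + b - Suc i)" using True by simp
  then have 2: "real b ^ (a + b - i) = real b * real b ^ (a + b - Suc i)" by simp
  have "binom_weight a b (Suc i) * (real i + 1) * real b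
      = ((real i + 1) * real ((a + b) choose Suc i)) * real a ^ Suc i * (real b * real b ^ (a + b - Suc i))"
    by (simp add: binom_weight_def)
  then show ?thesis by (simp only: 1 2[symmetric]) (simp add: binom_weight_def)
next
  case False
  then show ?thesis
    by (cases "i = a + b") (simp_all add: binom_weight_eq_0)
qed

lemma sum_binom_weight: "(\<Sum>i\<le>a + b. binom_weight a b i) = real (a + b) ^ (a + b)"
  using binomial_ring[of "real a" "real b" "a + b"] by (simp add: binom_weight_def)

text \<open>After scaling by \<open>a + b\<close>, the recurrence makes the partial sums telescope
  to a multiple of the next weight, which vanishes beyond \<open>a + b\<close>.\<close>

lemma sum_centred_binom_weight: "(\<Sum>i\<le>a + b. (real i - real a) * binom_weight a b i) = 0"
proof (cases "a + b = 0")
  case False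
  have "real (a + b) * (\<Sum>i\<le>m. (real i - real a) * binom_weight a b i)
      = - (binom_weight a b (Suc m) * (real m + 1) * real b)" for m
  proof (induction m)
    case 0
    then show ?case using binom_weight_Suc[of a b 0] by (simp add: algebra_simps)
  next
    case (Suc m)
    then show ?case using binom_weight_Suc[of a b "Suc m"] by (simp add: algebra_simps)
  qed
  from this[of "a + b"] False show ?thesis by (simp add: binom_weight_eq_0)
qed simp

text \<open>The reversal is permanent because the comparison of the two ratios of consecutive weights
  depends on \<open>j\<close> only through the sign of \<open>(j + 1)\<^sup>2 (b\<^sup>2 - a\<^sup>2) - b\<^sup>2 (2 a + 1)\<close>.\<close>

lemma binom_weight_single_crossing:
  fixes a b :: nat
  assumes "0 < a" "0 < b"
  defines "A \<equiv> \<lambda>j. if j \<le> a then binom_weight a b (a - j) else 0"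
    and "B \<equiv> \<lambda>j. binom_weight a b (a + 1 + j)"
  shows "(\<exists>c. (\<forall>j<c. B j \<le> A j) \<and> (\<forall>j\<ge>c. A j \<le> B j)) \<or> (\<forall>j. B j \<le> A j)"
proof (rule disjCI)
  assume False: "\<not> (\<forall>j. B j \<le> A j)"
  \<comment> \<open>The first strict reversal; the rest shows that it is never undone.\<close>
  define c where "c = (LEAST j. A j < B j)"
  have c: "A c < B c"
    unfolding c_def by (rule LeastI_ex) (use False in \<open>simp only: not_all not_le\<close>)
  have below: "B j \<le> A j" if "j < c" for j
    using not_less_Least[OF that[unfolded c_def]] by (simp only: not_less)
  have nonneg: "0 \<le> A j" "0 \<le> B j" for j
    by (simp_all add: A_def B_def binom_weight_nonneg)
  \<comment> \<open>\<open>qA j / pA j\<close> and \<open>qB j / pB j\<close> are the successive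
    ratios of \<open>A\<close> and \<open>B\<close>, read off from \<open>binom_weight_Suc\<close>;
    they may turn negative once \<open>j\<close> leaves the support.\<close>
  define pA qA pB qB where
    "pA j = (real b + real j + 1) * real a" and "qA j = (real a - real j) * real b" and
    "pB j = (real a + real j + 2) * real b" and "qB j = (real b - 1 - real j) * real a" for j :: nat
  have pos: "0 < pA j" "0 < pB j" for j using assms(1,2) by (simp_all add: pA_def pB_def)
  have recA: "A (Suc j) = A j * (qA j / pA j)" for j
  proof -
    have "A (Suc j) * pA j = A j * qA j"
    proof (cases "j < a")
      case True
      then have "a - j = Suc (a - Suc j)" by simp
      with binom_weight_Suc[of a b "a - Suc j"] True show ?thesis
        by (simp add: A_def pA_def qA_def of_nat_diff algebra_simps)
    qed (auto simp: A_def qA_def)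
    with pos(1)[of j] show ?thesis by (simp add: field_simps)
  qed
  have recB: "B (Suc j) = B j * (qB j / pB j)" for j
  proof -
    have "B (Suc j) * pB j = B j * qB j"
      using binom_weight_Suc[of a b "a + 1 + j"] by (simp add: B_def pB_def qB_def algebra_simps)
    with pos(2)[of j] show ?thesis by (simp add: field_simps)
  qed
  have ratio: "qA j / pA j < qB j / pB j \<longleftrightarrow>
      real b ^ 2 * (2 * real a + 1) < real (Suc j) ^ 2 * (real b ^ 2 - real a ^ 2)" for j
  proof -
    have "qB j * pA j - qA j * pB j
        = real (Suc j) ^ 2 * (real b ^ 2 - real a ^ 2) - real b ^ 2 * (2 * real a + 1)"
      unfolding pA_def pB_def qA_def qB_def of_nat_Suc by algebra
    moreover have "qA j / pA j < qB j / pB j \<longleftrightarrow> qA j * pB j < qB j * pA j"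
      using pos[of j] by (simp add: divide_simps mult.commute)
    ultimately show ?thesis by linarith
  qed
  \<comment> \<open>The two weights next to the midpoint satisfy
    \<open>B 0 * (a + 1) = A 0 * a\<close>, so there is no reversal at \<open>0\<close> and
    \<open>c\<close> has a predecessor \<open>d\<close>.\<close>
  have "0 < c"
  proof (rule ccontr)
    assume "\<not> 0 < c"
    then have "A 0 < B 0" using c by simp
    moreover have "B 0 * (real a + 1) * real b = A 0 * real b * real a"
      using binom_weight_Suc[of a b a] by (simp add: A_def B_def)
    ultimately have "B 0 * (real a + 1) * real b \<le> B 0 * real b * real a"
      using assms(1,2) by (simp add: mult_right_mono)
    then have "B 0 * real b \<le> 0" by (simp add: algebra_simps)
    with \<open>A 0 < B 0\<close> nonneg(1)[of 0] assms(1,2) show False by (simp add: mult_le_0_iff)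
  qed
  then obtain d where d: "c = Suc d" using gr0_implies_Suc by blast
  \<comment> \<open>The order flips between \<open>d\<close> and \<open>c\<close>, so the ratio of
    \<open>B\<close> is the larger one there; otherwise multiplying \<open>B d \<le> A d\<close> by
    the ratios would preserve the order.\<close>
  have "qA d / pA d < qB d / pB d"
  proof (rule ccontr)
    assume "\<not> qA d / pA d < qB d / pB d"
    then have le: "qB d / pB d \<le> qA d / pA d" by simp
    have "B d * (qB d / pB d) > 0"
      using c nonneg(1)[of c] recB[of d] d by simp
    then have "0 < qB d / pB d" using nonneg(2)[of d] unfolding zero_less_mult_iff by linarith
    then have "B d * (qB d / pB d) \<le> A d * (qA d / pA d)"
      using below[of d] d le nonneg by (intro mult_mono) auto
    with c recA[of d] recB[of d] d show False by simp
  qed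
  \<comment> \<open>The left side is non-negative, which forces the factor
    \<open>b ^ 2 - a ^ 2\<close> to be positive; the right side then grows with the index and the
    inequality persists.\<close>
  then have "real b ^ 2 * (2 * real a + 1) < real (Suc d) ^ 2 * (real b ^ 2 - real a ^ 2)"
    by (simp only: ratio)
  moreover from this have "0 < real b ^ 2 - real a ^ 2"
    by (smt (verit) mult_nonneg_nonneg of_nat_0_le_iff zero_le_power2 zero_less_mult_iff)
  moreover have "real (Suc d) ^ 2 \<le> real (Suc j) ^ 2" if "d \<le> j" for j
    using that by (intro power_mono) auto
  ultimately have r: "qA j / pA j < qB j / pB j" if "d \<le> j" for j
    unfolding ratio using that by (smt (verit) mult_right_mono)
  have "A j \<le> B j" if "c \<le> j" for j
    using that
  proof (induction j rule: dec_induct)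
    case base
    then show ?case using c by simp
  next
    case (step j)
    show ?case
    \<comment> \<open>Multiplying the inequalities needs a non-negative ratio for \<open>A\<close>;
      otherwise \<open>A (Suc j)\<close> is already at most \<open>0\<close>.\<close>
    proof (cases "qA j / pA j \<le> 0")
      case True
      then have "A (Suc j) \<le> 0" unfolding recA using nonneg(1)[of j] by (intro mult_nonneg_nonpos)
      then show ?thesis using nonneg(2)[of "Suc j"] by linarith
    next
      case False
      then show ?thesis
        unfolding recA recB using step r[of j] d nonneg by (intro mult_mono) auto
    qed
  qed
  with below show "\<exists>c. (\<forall>j<c. B j \<le> A j) \<and> (\<forall>j\<ge>c. A j \<le> B j)" by blast
qed

text \<open>The range is folded at \<open>a + 1 / 2\<close>, pairing \<open>a - j\<close> with
  \<open>a + 1 + j\<close>. Since the mean is \<open>a\<close>, the first moment about the fold is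
  not positive, and the single crossing turns this into a comparison of the two halves.\<close>

lemma binom_weight_median:
  "real (a + b) ^ (a + b) \<le> 2 * (\<Sum>i\<le>a. binom_weight a b i)"
proof (cases "a = 0 \<or> b = 0")
  case True
  then show ?thesis
  proof
    assume "a = 0"
    then show ?thesis by (simp add: binom_weight_def)
  next
    assume "b = 0"
    then show ?thesis using sum_binom_weight[of a b] by simp
  qed
next
  case False
  define A B where "A j = (if j \<le> a then binom_weight a b (a - j) else 0)"
    and "B j = binom_weight a b (a + 1 + j)" for j
  \<comment> \<open>Both halves are padded by zeros up to \<open>a + b\<close>; the truncated
    \<open>a - j\<close> for \<open>j > a\<close> is harmless because \<open>A j = 0\<close>
    there.\<close>
  have split: "(\<Sum>i\<le>a + b. g i * binom_weight a b i)
      = (\<Sum>j\<le>a + b. g (a - j) * A j) + (\<Sum>j\<le>a + b. g (a + 1 + j) * B j)" for g :: "nat \<Rightarrow> real"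
  proof -
    have "(\<Sum>i\<le>a + b. g i * binom_weight a b i)
        = (\<Sum>i\<le>a. g i * binom_weight a b i) + (\<Sum>i\<in>{a + 1..a + b}. g i * binom_weight a b i)"
      by (subst sum.union_disjoint[symmetric]) (auto intro!: sum.cong)
    moreover have "(\<Sum>i\<le>a. g i * binom_weight a b i) = (\<Sum>j\<le>a. g (a - j) * A j)"
      by (rule sum.reindex_bij_witness[of _ "\<lambda>j. a - j" "\<lambda>j. a - j"]) (auto simp: A_def)
    moreover have "\<dots> = (\<Sum>j\<le>a + b. g (a - j) * A j)"
      by (rule sum.mono_neutral_left) (auto simp: A_def)
    moreover have "(\<Sum>i\<in>{a + 1..a + b}. g i * binom_weight a b i) = (\<Sum>j<b. g (a + 1 + j) * B j)"
      by (rule sum.reindex_bij_witness[of _ "\<lambda>j. a + 1 + j" "\<lambda>i. i - (a + 1)"]) (auto simp: B_def)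
    moreover have "\<dots> = (\<Sum>j\<le>a + b. g (a + 1 + j) * B j)"
      by (rule sum.mono_neutral_left) (auto simp: B_def binom_weight_eq_0)
    ultimately show ?thesis by simp
  qed
  have low: "(\<Sum>i\<le>a. binom_weight a b i) = (\<Sum>j\<le>a + b. A j)"
  proof -
    have "(\<Sum>i\<le>a. binom_weight a b i) = (\<Sum>j\<le>a. A j)"
      by (rule sum.reindex_bij_witness[of _ "\<lambda>j. a - j" "\<lambda>j. a - j"]) (auto simp: A_def)
    also have "\<dots> = (\<Sum>j\<le>a + b. A j)"
      by (rule sum.mono_neutral_left) (auto simp: A_def)
    finally show ?thesis .
  qed
  have total: "real (a + b) ^ (a + b) = (\<Sum>j\<le>a + b. A j) + (\<Sum>j\<le>a + b. B j)"
    using split[of "\<lambda>_. 1"] sum_binom_weight[of a b] by simp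
  have "(\<Sum>j\<le>a + b. (real j + 1 / 2) * (B j - A j))
      = (\<Sum>j\<le>a + b. (real (a - j) - real a - 1 / 2) * A j)
        + (\<Sum>j\<le>a + b. (real (a + 1 + j) - real a - 1 / 2) * B j)"
    unfolding sum.distrib[symmetric]
    by (rule sum.cong) (auto simp: A_def of_nat_diff algebra_simps)
  also have "\<dots> = (\<Sum>i\<le>a + b. (real i - real a - 1 / 2) * binom_weight a b i)"
    using split[of "\<lambda>i. real i - real a - 1 / 2"] by simp
  also have "\<dots> = - (\<Sum>i\<le>a + b. binom_weight a b i) / 2"
    using sum_centred_binom_weight[of a b]
    by (simp add: left_diff_distrib sum_subtractf sum_divide_distrib)
  also have "\<dots> \<le> 0" by (simp add: sum_nonneg binom_weight_nonneg)
  finally have moment: "(\<Sum>j\<le>a + b. (real j + 1 / 2) * (B j - A j)) \<le> 0" .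
  have ab: "0 < a" "0 < b" using False by auto
  have "(\<Sum>j\<le>a + b. B j - A j) \<le> 0"
    using binom_weight_single_crossing[OF ab, folded A_def B_def]
  proof (elim disjE exE conjE)
    assume "\<forall>j. B j \<le> A j"
    then show ?thesis by (intro sum_nonpos) simp
  next
    fix c assume "\<forall>j<c. B j \<le> A j" "\<forall>j\<ge>c. A j \<le> B j"
    then show ?thesis
      by (intro sum_nonpos_of_single_crossing[OF _ _ moment, of c]) simp_all
  qed
  then show ?thesis unfolding low total by (simp add: sum_subtractf)
qed

text \<open>At success probability \<open>k / n\<close> the mean is the integer \<open>k\<close>,
  and the point masses are \<open>binom_weight k (n - k)\<close> divided by
  \<open>n ^ n\<close>.\<close>

lemma binomial_pmf_median_le:
  assumes "0 < n" "k \<le> n"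
  shows "1 / 2 \<le> measure_pmf.prob (binomial_pmf n (real k / real n)) {..k}"
proof -
  define b where "b = n - k"
  have n: "n = k + b" using assms by (simp add: b_def)
  have q: "1 - real k / real n = real b / real n" using assms by (simp add: b_def of_nat_diff field_simps)
  have "measure_pmf.prob (binomial_pmf n (real k / real n)) {..k}
      = (\<Sum>i\<le>k. real (n choose i) * (real k / real n) ^ i * (real b / real n) ^ (n - i))"
    using assms by (simp add: measure_measure_pmf_finite q)
  also have "\<dots> = (\<Sum>i\<le>k. binom_weight k b i / real n ^ n)"
  proof (rule sum.cong)
    fix i assume "i \<in> {..k}"
    then have "real n ^ n = real n ^ i * real n ^ (n - i)"
      using assms by (simp flip: power_add)
    then show "real (n choose i) * (real k / real n) ^ i * (real b / real n) ^ (n - i) = binom_weight k b i / real n ^ n"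
      by (simp add: binom_weight_def n[symmetric] power_divide)
  qed simp
  also have "\<dots> \<ge> 1 / 2"
    using binom_weight_median[of k b, folded n] assms
    by (simp add: sum_divide_distrib[symmetric] pos_le_divide_eq)
  finally show ?thesis .
qed

text \<open>Exchanging successes and failures turns this upper tail into the lower tail at
  \<open>n - k\<close>.\<close>

lemma binomial_pmf_median_ge:
  assumes "0 < n" "k \<le> n"
  shows "1 / 2 \<le> measure_pmf.prob (binomial_pmf n (real k / real n)) {k..}"
proof -
  have q: "1 - real k / real n = real (n - k) / real n" using assms by (simp add: of_nat_diff field_simps)
  have p: "1 - real (n - k) / real n = real k / real n" using assms by (simp add: of_nat_diff field_simps)
  have pq: "0 \<le> real k / real n" "real k / real n \<le> 1" "real (n - k) / real n \<le> 1" using assms by auto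
  have "measure_pmf.prob (binomial_pmf n (real (n - k) / real n)) {..n - k}
      = (\<Sum>i\<le>n - k. real (n choose i) * (real (n - k) / real n) ^ i * (real k / real n) ^ (n - i))"
    using pq by (simp add: measure_measure_pmf_finite p)
  also have "\<dots> = (\<Sum>i\<in>{k..n}. real (n choose i) * (real k / real n) ^ i * (real (n - k) / real n) ^ (n - i))"
    by (rule sum.reindex_bij_witness[of _ "\<lambda>i. n - i" "\<lambda>i. n - i"])
      (use assms in \<open>auto simp: binomial_symmetric[symmetric]\<close>)
  also have "\<dots> = measure_pmf.prob (binomial_pmf n (real k / real n)) {k..n}"
    using pq by (simp add: measure_measure_pmf_finite q)
  also have "\<dots> \<le> measure_pmf.prob (binomial_pmf n (real k / real n)) {k..}"
    by (rule measure_pmf.finite_measure_mono) auto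
  finally show ?thesis using binomial_pmf_median_le[of n "n - k"] assms by simp
qed

section \<open>Finite-horizon events of Bernoulli processes\<close>

text \<open>Coordinates beyond the horizon are frozen at \<open>False\<close>, so the law lives on
  finitely many paths of the same type as the infinite ones.\<close>

definition coin_pmf :: "nat \<Rightarrow> real \<Rightarrow> (nat \<Rightarrow> bool) pmf" where
  "coin_pmf n p = Pi_pmf {1..n} False (\<lambda>_. bernoulli_pmf p)"

text \<open>The independent conjunction of two coins is the monotone coupling in the parameter.\<close>

lemma coin_pmf_thin:
  assumes "0 \<le> p" "p \<le> q" "q \<le> 1"
  obtains C :: "(nat \<Rightarrow> bool \<times> bool) pmf" where
    "coin_pmf n q = map_pmf (\<lambda>h. fst \<circ> h) C"
    "coin_pmf n p = map_pmf (\<lambda>h. (\<lambda>(x, y). x \<and> y) \<circ> h) C"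
proof -
  \<comment> \<open>The thinning probability: a head of the \<open>q\<close>-coin is kept with
    probability \<open>r\<close>. For \<open>q = 0\<close> also \<open>p = 0\<close>.\<close>
  define r where "r = (if q = 0 then 0 else p / q)"
  have r: "0 \<le> r" "r \<le> 1" "q * r = p" using assms by (auto simp: r_def field_simps)
  define D where "D = pair_pmf (bernoulli_pmf q) (bernoulli_pmf r)"
  have 1: "map_pmf fst D = bernoulli_pmf q" by (simp add: D_def map_fst_pair_pmf)
  have "pmf (map_pmf (\<lambda>(x, y). x \<and> y) D) True = measure_pmf.prob D {(True, True)}"
    by (auto simp: pmf_map intro!: arg_cong[where f = "measure_pmf.prob D"])
  also have "\<dots> = p" using assms r by (simp add: measure_pmf_single D_def pmf_pair)
  finally have T: "pmf (map_pmf (\<lambda>(x, y). x \<and> y) D) True = pmf (bernoulli_pmf p) True"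
    using assms by simp
  \<comment> \<open>A law on two points is fixed by its mass at \<open>True\<close>.\<close>
  have F: "pmf M False = 1 - pmf M True" for M :: "bool pmf"
    using sum_pmf_eq_1[of "UNIV :: bool set" M] by (simp add: UNIV_bool[symmetric]) (simp add: UNIV_bool)
  have 2: "map_pmf (\<lambda>(x, y). x \<and> y) D = bernoulli_pmf p"
  proof (rule pmf_eqI)
    fix i show "pmf (map_pmf (\<lambda>(x, y). x \<and> y) D) i = pmf (bernoulli_pmf p) i"
      by (cases i) (simp_all only: T F)
  qed
  show ?thesis
  proof (rule that[of "Pi_pmf {1..n} (False, False) (\<lambda>_. D)"])
    show "coin_pmf n q = map_pmf (\<lambda>h. fst \<circ> h) (Pi_pmf {1..n} (False, False) (\<lambda>_. D))"
      unfolding coin_pmf_def by (subst Pi_pmf_map[symmetric]) (simp_all add: 1)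
    show "coin_pmf n p = map_pmf (\<lambda>h. (\<lambda>(x, y). x \<and> y) \<circ> h) (Pi_pmf {1..n} (False, False) (\<lambda>_. D))"
      unfolding coin_pmf_def by (subst Pi_pmf_map[symmetric]) (simp_all add: 2)
  qed
qed

text \<open>In the coupling the \<open>p\<close>-path lies pointwise below the
  \<open>q\<close>-path, so an upward closed event passes from one to the other sample by
  sample.\<close>

lemma coin_pmf_prob_mono:
  assumes "0 \<le> p" "p \<le> q" "q \<le> 1"
    and "\<And>f g. Q f \<Longrightarrow> (\<And>i. f i \<Longrightarrow> g i) \<Longrightarrow> Q g"
  shows "measure_pmf.prob (coin_pmf n p) {f. Q f} \<le> measure_pmf.prob (coin_pmf n q) {f. Q f}"
proof -
  obtain C where C: "coin_pmf n q = map_pmf (\<lambda>h. fst \<circ> h) C"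
    "coin_pmf n p = map_pmf (\<lambda>h. (\<lambda>(x, y). x \<and> y) \<circ> h) C"
    using coin_pmf_thin[OF assms(1-3), of n] by blast
  show ?thesis unfolding C measure_map_pmf
    by (rule measure_pmf.finite_measure_mono) (auto elim!: assms(4) split: prod.splits)
qed

lemma coin_pmf_prob_antimono:
  assumes "0 \<le> p" "p \<le> q" "q \<le> 1"
    and "\<And>f g. Q g \<Longrightarrow> (\<And>i. f i \<Longrightarrow> g i) \<Longrightarrow> Q f"
  shows "measure_pmf.prob (coin_pmf n q) {f. Q f} \<le> measure_pmf.prob (coin_pmf n p) {f. Q f}"
proof -
  obtain C where C: "coin_pmf n q = map_pmf (\<lambda>h. fst \<circ> h) C"
    "coin_pmf n p = map_pmf (\<lambda>h. (\<lambda>(x, y). x \<and> y) \<circ> h) C"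
    using coin_pmf_thin[OF assms(1-3), of n] by blast
  show ?thesis unfolding C measure_map_pmf
    by (rule measure_pmf.finite_measure_mono) (auto elim!: assms(4) split: prod.splits)
qed

text \<open>Stated on whole paths, so that one predicate can be evaluated both on sampled paths of
  the process and on the padded paths of \<open>coin_pmf\<close>.\<close>

definition determined :: "nat \<Rightarrow> ((nat \<Rightarrow> bool) \<Rightarrow> bool) \<Rightarrow> bool" where
  "determined n Q \<longleftrightarrow> (\<forall>f g. (\<forall>i\<in>{1..n}. f i = g i) \<longrightarrow> Q f = Q g)"

lemma determined_disj: "determined n Q \<Longrightarrow> determined n R \<Longrightarrow> determined n (\<lambda>f. Q f \<or> R f)"
  unfolding determined_def by (intro allI impI arg_cong2[where f = "(\<or>)"]) simp_all

lemma bernoulli_process_prefix: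
  fixes X :: "nat \<Rightarrow> 'a \<Rightarrow> bool"
  assumes "bernoulli_process M X p" "f \<in> PiE_dflt {1..n} False (\<lambda>_. UNIV)"
  shows "{\<omega> \<in> space M. \<forall>i\<in>{1..n}. X i \<omega> = f i} \<in> sets M"
    and "measure M {\<omega> \<in> space M. \<forall>i\<in>{1..n}. X i \<omega> = f i} = pmf (coin_pmf n p) f"
proof -
  interpret prob_space M using assms(1) by (simp add: bernoulli_process_def)
  have ind: "indep_vars (\<lambda>_. count_space UNIV) X {1..}"
    and d: "\<And>i. 1 \<le> i \<Longrightarrow> distr M (count_space UNIV) (X i) = measure_pmf (bernoulli_pmf p)"
    using assms(1) by (auto simp: bernoulli_process_def)
  have [measurable]: "random_variable (count_space UNIV) (X i)" if "1 \<le> i" for i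
    using ind that by (auto simp: indep_vars_def)
  have coord: "X i -` {f i} \<inter> space M \<in> sets M" if "i \<in> {1..n}" for i
    using that by (intro measurable_sets[of _ _ "count_space UNIV"]) auto
  \<comment> \<open>The extra \<open>space M\<close> matters for \<open>n = 0\<close>, where the
    intersection over the empty index set is the whole type.\<close>
  have eq: "{\<omega> \<in> space M. \<forall>i\<in>{1..n}. X i \<omega> = f i} = space M \<inter> (\<Inter>i\<in>{1..n}. X i -` {f i} \<inter> space M)"
    by auto
  show "{\<omega> \<in> space M. \<forall>i\<in>{1..n}. X i \<omega> = f i} \<in> sets M"
  proof (cases "n = 0")
    case False
    have "(\<Inter>i\<in>{1..n}. X i -` {f i} \<inter> space M) \<in> sets M"
      using False by (intro sets.finite_INT coord) auto
    then show ?thesis unfolding eq by (rule sets.Int[OF sets.top])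
  qed simp
  have f: "\<And>i. i \<notin> {1..n} \<Longrightarrow> f i = False" using assms(2) by (auto simp: PiE_dflt_def)
  show "measure M {\<omega> \<in> space M. \<forall>i\<in>{1..n}. X i \<omega> = f i} = pmf (coin_pmf n p) f"
  proof (cases "n = 0")
    case True
    moreover have "f = (\<lambda>_. False)" using f True by auto
    ultimately show ?thesis by (simp add: coin_pmf_def prob_space)
  next
    case False
    then have "measure M {\<omega> \<in> space M. \<forall>i\<in>{1..n}. X i \<omega> = f i} = prob (\<Inter>i\<in>{1..n}. X i -` {f i} \<inter> space M)"
      by (intro arg_cong[where f = prob]) auto
    also have "\<dots> = (\<Prod>i\<in>{1..n}. prob (X i -` {f i} \<inter> space M))"
      using False by (intro indep_varsD[OF ind]) auto
    also have "\<dots> = (\<Prod>i\<in>{1..n}. pmf (bernoulli_pmf p) (f i))"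
    proof (rule prod.cong)
      fix i assume i: "i \<in> {1..n}"
      then have "prob (X i -` {f i} \<inter> space M) = measure (distr M (count_space UNIV) (X i)) {f i}"
        by (subst measure_distr) auto
      then show "prob (X i -` {f i} \<inter> space M) = pmf (bernoulli_pmf p) (f i)"
        using i by (simp add: d measure_pmf_single)
    qed simp
    also have "\<dots> = pmf (coin_pmf n p) f"
      unfolding coin_pmf_def using f by (subst pmf_Pi') auto
    finally show ?thesis .
  qed
qed

text \<open>The event is a finite disjoint union of cylinders, one for each path in \<open>Q\<close>
  that is padded by \<open>False\<close> outside the horizon.\<close>

lemma bernoulli_process_event:
  fixes X :: "nat \<Rightarrow> 'a \<Rightarrow> bool"
  assumes "bernoulli_process M X p" "determined n Q"
  shows "{\<omega> \<in> space M. Q (\<lambda>i. X i \<omega>)} \<in> sets M" (is "?E \<in> _")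
    and "measure M {\<omega> \<in> space M. Q (\<lambda>i. X i \<omega>)} = measure_pmf.prob (coin_pmf n p) {f. Q f}"
proof -
  interpret prob_space M using assms(1) by (simp add: bernoulli_process_def)
  define F where "F = {f \<in> PiE_dflt {1..n} False (\<lambda>_. UNIV). Q f}"
  define cyl where "cyl f = {\<omega> \<in> space M. \<forall>i\<in>{1..n}. X i \<omega> = f i}" for f
  have finF: "finite F"
    unfolding F_def using finite_PiE_dflt[of "{1..n}" "\<lambda>_. UNIV :: bool set" False] by simp
  have E: "?E = (\<Union>f\<in>F. cyl f)"
  proof (intro set_eqI iffI)
    fix \<omega> assume \<omega>: "\<omega> \<in> ?E"
    let ?f = "\<lambda>i. i \<in> {1..n} \<and> X i \<omega>"
    have "Q ?f = Q (\<lambda>i. X i \<omega>)"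
      by (rule assms(2)[unfolded determined_def, rule_format]) simp
    then have "?f \<in> F" using \<omega> by (auto simp: F_def PiE_dflt_def)
    moreover have "\<omega> \<in> cyl ?f" using \<omega> by (auto simp: cyl_def)
    ultimately show "\<omega> \<in> (\<Union>f\<in>F. cyl f)" by blast
  next
    fix \<omega> assume "\<omega> \<in> (\<Union>f\<in>F. cyl f)"
    then obtain f where f: "f \<in> F" "\<omega> \<in> cyl f" by blast
    then have "Q (\<lambda>i. X i \<omega>) = Q f"
      by (intro assms(2)[unfolded determined_def, rule_format]) (simp add: cyl_def)
    with f show "\<omega> \<in> ?E" by (auto simp: F_def cyl_def)
  qed
  have cyl: "cyl f \<in> sets M" "measure M (cyl f) = pmf (coin_pmf n p) f" if "f \<in> F" for f
    using bernoulli_process_prefix[OF assms(1), of f n] that by (auto simp: F_def cyl_def)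
  show "?E \<in> sets M" unfolding E using finF cyl by auto
  have disj: "disjoint_family_on cyl F"
    unfolding disjoint_family_on_def
  proof (intro ballI impI)
    fix f g assume fg: "f \<in> F" "g \<in> F" "f \<noteq> g"
    then obtain i where "f i \<noteq> g i" by blast
    with fg have "i \<in> {1..n}" by (cases "i \<in> {1..n}") (auto simp: F_def PiE_dflt_def)
    with \<open>f i \<noteq> g i\<close> show "cyl f \<inter> cyl g = {}" by (auto simp: cyl_def)
  qed
  have "measure M ?E = (\<Sum>f\<in>F. measure M (cyl f))"
    unfolding E using finF cyl(1) disj by (intro finite_measure_finite_Union) auto
  also have "\<dots> = (\<Sum>f\<in>F. pmf (coin_pmf n p) f)" by (simp add: cyl)
  also have "\<dots> = measure_pmf.prob (coin_pmf n p) F"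
    using finF by (simp add: measure_measure_pmf_finite)
  \<comment> \<open>\<open>F\<close> keeps only padded paths, on which \<open>coin_pmf\<close> is
    concentrated.\<close>
  also have "\<dots> = measure_pmf.prob (coin_pmf n p) {f. Q f}"
  proof (rule measure_pmf.finite_measure_eq_AE)
    show "AE f in coin_pmf n p. (f \<in> F) = (f \<in> {f. Q f})"
      unfolding AE_measure_pmf_iff coin_pmf_def
      using set_Pi_pmf_subset[of "{1..n}" False "\<lambda>_. bernoulli_pmf p"]
      by (auto simp: F_def PiE_dflt_def)
  qed auto
  finally show "measure M ?E = measure_pmf.prob (coin_pmf n p) {f. Q f}" .
qed

section \<open>Head counts and probabilities of path events\<close>

abbreviation heads :: "nat \<Rightarrow> (nat \<Rightarrow> bool) \<Rightarrow> int" where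
  "heads k f \<equiv> partial_sum (\<lambda>i f. f i) k f"

text \<open>Moves partial sums from the sample space to the sampled path, so that hitting events
  become predicates on paths.\<close>

lemma partial_sum_eq_heads: "partial_sum X k \<omega> = heads k (\<lambda>i. X i \<omega>)"
  by (simp add: partial_sum_def)

lemma heads_mono: "(\<And>i. f i \<Longrightarrow> g i) \<Longrightarrow> heads k f \<le> heads k g"
  unfolding partial_sum_def by (rule sum_mono) auto

lemma heads_cong: "(\<And>i. 1 \<le> i \<Longrightarrow> i \<le> k \<Longrightarrow> f i = g i) \<Longrightarrow> heads k f = heads k g"
  unfolding partial_sum_def by (rule sum.cong) auto

lemma heads_nonneg: "0 \<le> heads k f"
  unfolding partial_sum_def by (rule sum_nonneg) auto

lemma heads_le: "heads k f \<le> int k"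
  using sum_mono[of "{1..k}" "\<lambda>i. of_bool (f i) :: int" "\<lambda>_. 1"] by (simp add: partial_sum_def)

lemma coin_pmf_heads:
  assumes "p \<in> {0..1}"
  shows "measure_pmf.prob (coin_pmf n p) {f. R (heads n f)}
    = measure_pmf.prob (binomial_pmf n p) {k. R (int k)}"
proof -
  have h: "heads n f = int (card {i \<in> {1..n}. f i})" for f
    by (simp add: partial_sum_def of_bool_def sum.If_cases Int_def)
  have "binomial_pmf n p = map_pmf (\<lambda>f. card {i \<in> {1..n}. f i}) (coin_pmf n p)"
    unfolding coin_pmf_def by (rule binomial_pmf_altdef') (use assms in auto)
  then show ?thesis by (simp add: h vimage_def)
qed


lemma determined_heads:
  assumes "\<And>f g. (\<And>k. k \<le> n \<Longrightarrow> heads k f = heads k g) \<Longrightarrow> Q f = Q g"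
  shows "determined n Q"
  unfolding determined_def by (intro allI impI assms heads_cong) auto

definition event_prob :: "'a measure \<Rightarrow> (nat \<Rightarrow> 'a \<Rightarrow> bool) \<Rightarrow> ((nat \<Rightarrow> bool) \<Rightarrow> bool) \<Rightarrow> real" where
  "event_prob M X Q = measure M {\<omega> \<in> space M. Q (\<lambda>i. X i \<omega>)}"

lemma event_prob_nonneg: "0 \<le> event_prob M X Q"
  by (simp add: event_prob_def)

lemma event_prob_False: "(\<And>f. \<not> Q f) \<Longrightarrow> event_prob M X Q = 0"
  by (simp add: event_prob_def)

lemma event_prob_mono:
  assumes "bernoulli_process M X p" "determined n R" "\<And>f. Q f \<Longrightarrow> R f"
  shows "event_prob M X Q \<le> event_prob M X R"
proof -
  interpret prob_space M using assms(1) by (simp add: bernoulli_process_def)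
  show ?thesis unfolding event_prob_def
    by (rule finite_measure_mono) (use assms bernoulli_process_event(1) in auto)
qed

lemma event_prob_subadditive:
  assumes "bernoulli_process M X p" "determined n Q" "determined m R" "\<And>f. S f \<Longrightarrow> Q f \<or> R f"
  shows "event_prob M X S \<le> event_prob M X Q + event_prob M X R"
proof -
  interpret prob_space M using assms(1) by (simp add: bernoulli_process_def)
  note m = bernoulli_process_event(1)[OF assms(1,2)] bernoulli_process_event(1)[OF assms(1,3)]
  have "event_prob M X S \<le> prob ({\<omega> \<in> space M. Q (\<lambda>i. X i \<omega>)} \<union> {\<omega> \<in> space M. R (\<lambda>i. X i \<omega>)})"
    unfolding event_prob_def by (rule finite_measure_mono) (use assms(4) m in auto)
  also have "\<dots> \<le> event_prob M X Q + event_prob M X R"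
    unfolding event_prob_def by (rule measure_Un_le) (use m in auto)
  finally show ?thesis .
qed

text \<open>Continuity from below: a bound uniform in the horizon survives its removal.\<close>

lemma event_prob_Ex:
  assumes "bernoulli_process M X p" "\<And>n. determined n (Q n)" "\<And>n f. Q n f \<Longrightarrow> Q (Suc n) f"
    and "\<And>n. event_prob M X (Q n) \<le> c"
  shows "{\<omega> \<in> space M. \<exists>n. Q n (\<lambda>i. X i \<omega>)} \<in> sets M"
    and "measure M {\<omega> \<in> space M. \<exists>n. Q n (\<lambda>i. X i \<omega>)} \<le> c"
proof -
  interpret prob_space M using assms(1) by (simp add: bernoulli_process_def)
  let ?A = "\<lambda>n. {\<omega> \<in> space M. Q n (\<lambda>i. X i \<omega>)}"
  have m: "range ?A \<subseteq> events" using bernoulli_process_event(1)[OF assms(1,2)] by auto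
  have eq: "{\<omega> \<in> space M. \<exists>n. Q n (\<lambda>i. X i \<omega>)} = (\<Union>n. ?A n)" by auto
  show "{\<omega> \<in> space M. \<exists>n. Q n (\<lambda>i. X i \<omega>)} \<in> events"
    unfolding eq using m by (rule sets.countable_UN)
  have "incseq ?A" by (rule incseq_SucI) (auto intro: assms(3))
  then have "(\<lambda>n. prob (?A n)) \<longlonglongrightarrow> prob (\<Union>n. ?A n)"
    using m by (intro finite_Lim_measure_incseq)
  then show "prob {\<omega> \<in> space M. \<exists>n. Q n (\<lambda>i. X i \<omega>)} \<le> c"
    unfolding eq by (rule LIMSEQ_le_const2) (use assms(4) in \<open>auto simp: event_prob_def\<close>)
qed

lemma event_prob_increasing:
  assumes "bernoulli_process M X p" "bernoulli_process N Y q" "0 \<le> p" "p \<le> q" "q \<le> 1"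
    and "determined n Q" "\<And>f g. Q f \<Longrightarrow> (\<And>i. f i \<Longrightarrow> g i) \<Longrightarrow> Q g"
  shows "event_prob M X Q \<le> event_prob N Y Q"
  unfolding event_prob_def bernoulli_process_event(2)[OF assms(1,6)]
    bernoulli_process_event(2)[OF assms(2,6)]
  by (rule coin_pmf_prob_mono) (use assms in auto)

lemma event_prob_decreasing:
  assumes "bernoulli_process M X p" "bernoulli_process N Y q" "0 \<le> p" "p \<le> q" "q \<le> 1"
    and "determined n Q" "\<And>f g. Q g \<Longrightarrow> (\<And>i. f i \<Longrightarrow> g i) \<Longrightarrow> Q f"
  shows "event_prob N Y Q \<le> event_prob M X Q"
  unfolding event_prob_def bernoulli_process_event(2)[OF assms(1,6)]
    bernoulli_process_event(2)[OF assms(2,6)]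
  by (rule coin_pmf_prob_antimono) (use assms in auto)

lemma event_prob_heads:
  assumes "bernoulli_process M X p" "p \<in> {0..1}"
  shows "event_prob M X (\<lambda>f. R (heads n f)) = measure_pmf.prob (binomial_pmf n p) {k. R (int k)}"
proof -
  have "determined n (\<lambda>f. R (heads n f))" by (rule determined_heads) simp
  from bernoulli_process_event(2)[OF assms(1) this] show ?thesis
    by (simp only: event_prob_def coin_pmf_heads[OF assms(2)])
qed

section \<open>Crossings before a horizon\<close>

definition no_hit :: "(nat \<Rightarrow> int) \<Rightarrow> (nat \<Rightarrow> int) \<Rightarrow> nat \<Rightarrow> (nat \<Rightarrow> bool) \<Rightarrow> bool" where
  "no_hit U L n f \<longleftrightarrow> (\<forall>k. 1 \<le> k \<and> k < n \<longrightarrow> heads k f < U k \<and> L k < heads k f)"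

text \<open>Only the opposite boundary is excluded before the crossing, which makes the monotonicity of
  these events in the path evident.\<close>

definition upper_hit :: "(nat \<Rightarrow> int) \<Rightarrow> (nat \<Rightarrow> int) \<Rightarrow> nat \<Rightarrow> (nat \<Rightarrow> bool) \<Rightarrow> bool" where
  "upper_hit U L n f \<longleftrightarrow>
     (\<exists>k. 1 \<le> k \<and> k < n \<and> U k \<le> heads k f \<and> (\<forall>j. 1 \<le> j \<and> j < k \<longrightarrow> L j < heads j f))"

definition lower_hit :: "(nat \<Rightarrow> int) \<Rightarrow> (nat \<Rightarrow> int) \<Rightarrow> nat \<Rightarrow> (nat \<Rightarrow> bool) \<Rightarrow> bool" where
  "lower_hit U L n f \<longleftrightarrow>
     (\<exists>k. 1 \<le> k \<and> k < n \<and> heads k f \<le> L k \<and> (\<forall>j. 1 \<le> j \<and> j < k \<longrightarrow> heads j f < U j))"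

lemma determined_no_hit_heads: "determined n (\<lambda>f. no_hit U L n f \<and> R (heads n f))"
  by (rule determined_heads) (simp add: no_hit_def)

lemma determined_no_hit: "determined n (no_hit U L n)"
  by (rule determined_heads) (simp add: no_hit_def)

lemma determined_upper_hit: "determined n (upper_hit U L n)"
proof (rule determined_heads)
  fix f g assume *: "\<And>k. k \<le> n \<Longrightarrow> heads k f = heads k g"
  show "upper_hit U L n f = upper_hit U L n g"
    unfolding upper_hit_def by (rule ex_cong1) (auto simp: *)
qed

lemma determined_lower_hit: "determined n (lower_hit U L n)"
proof (rule determined_heads)
  fix f g assume *: "\<And>k. k \<le> n \<Longrightarrow> heads k f = heads k g"
  show "lower_hit U L n f = lower_hit U L n g"
    unfolding lower_hit_def by (rule ex_cong1) (auto simp: *)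
qed

lemma upper_hit_increasing:
  assumes "upper_hit U L n f" "\<And>i. f i \<Longrightarrow> g i"
  shows "upper_hit U L n g"
proof -
  have le: "heads k f \<le> heads k g" for k using assms(2) by (rule heads_mono)
  obtain k where k: "1 \<le> k" "k < n" "U k \<le> heads k f" "\<And>j. 1 \<le> j \<Longrightarrow> j < k \<Longrightarrow> L j < heads j f"
    using assms(1) unfolding upper_hit_def by blast
  show ?thesis unfolding upper_hit_def
    by (rule exI[of _ k]) (use k order_trans[OF k(3) le] order_less_le_trans[OF k(4) le] in simp)
qed

lemma lower_hit_decreasing:
  assumes "lower_hit U L n g" "\<And>i. f i \<Longrightarrow> g i"
  shows "lower_hit U L n f"
proof -
  have le: "heads k f \<le> heads k g" for k using assms(2) by (rule heads_mono)
  obtain k where k: "1 \<le> k" "k < n" "heads k g \<le> L k" "\<And>j. 1 \<le> j \<Longrightarrow> j < k \<Longrightarrow> heads j g < U j"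
    using assms(1) unfolding lower_hit_def by blast
  show ?thesis unfolding lower_hit_def
    by (rule exI[of _ k]) (use k order_trans[OF le k(3)] order_le_less_trans[OF le k(4)] in simp)
qed

lemma upper_hit_Suc: "upper_hit U L (Suc n) f \<longleftrightarrow>
    upper_hit U L n f \<or> (1 \<le> n \<and> U n \<le> heads n f \<and> (\<forall>j. 1 \<le> j \<and> j < n \<longrightarrow> L j < heads j f))"
  unfolding upper_hit_def less_Suc_eq by blast

lemma lower_hit_Suc: "lower_hit U L (Suc n) f \<longleftrightarrow>
    lower_hit U L n f \<or> (1 \<le> n \<and> heads n f \<le> L n \<and> (\<forall>j. 1 \<le> j \<and> j < n \<longrightarrow> heads j f < U j))"
  unfolding lower_hit_def less_Suc_eq by blast

text \<open>Induction on the horizon: a path without a hit so far stays inside at the next index or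
  meets a boundary there, having met neither before.\<close>

lemma hit_cases: "no_hit U L n f \<or> upper_hit U L n f \<or> lower_hit U L n f"
proof (induction n)
  case 0
  then show ?case by (simp add: no_hit_def)
next
  case (Suc n)
  have "no_hit U L n f \<Longrightarrow> no_hit U L (Suc n) f \<or> upper_hit U L (Suc n) f \<or> lower_hit U L (Suc n) f"
    unfolding upper_hit_Suc lower_hit_Suc unfolding no_hit_def less_Suc_eq
    by (metis not_less)
  with Suc show ?case using upper_hit_Suc lower_hit_Suc by blast
qed

text \<open>The alternatives are the two events charged in \<open>upper_spent\<close>. A first
  crossing at \<open>n\<close> excludes an earlier lower hit, so \<open>hit_cases\<close> leaves
  only \<open>no_hit\<close>.\<close>

lemma upper_hit_Suc_cases:
  assumes "upper_hit U L (Suc n) f"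
  shows "(no_hit U L n f \<and> U n \<le> heads n f) \<or> upper_hit U L n f"
proof (rule disjCI)
  assume n: "\<not> upper_hit U L n f"
  with assms have "U n \<le> heads n f" "\<forall>j. 1 \<le> j \<and> j < n \<longrightarrow> L j < heads j f"
    by (auto simp: upper_hit_Suc)
  moreover from this(2) have "\<not> lower_hit U L n f"
    unfolding lower_hit_def by (meson not_less)
  ultimately show "no_hit U L n f \<and> U n \<le> heads n f"
    using hit_cases[of U L n f] n by blast
qed

lemma lower_hit_Suc_cases:
  assumes "lower_hit U L (Suc n) f"
  shows "(no_hit U L n f \<and> heads n f \<le> L n) \<or> lower_hit U L n f"
proof (rule disjCI)
  assume n: "\<not> lower_hit U L n f"
  with assms have "heads n f \<le> L n" "\<forall>j. 1 \<le> j \<and> j < n \<longrightarrow> heads j f < U j"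
    by (auto simp: lower_hit_Suc)
  moreover from this(2) have "\<not> upper_hit U L n f"
    unfolding upper_hit_def by (meson not_less)
  ultimately show "no_hit U L n f \<and> heads n f \<le> L n"
    using hit_cases[of U L n f] n by blast
qed

lemma hit_time_ge_iff: "enat n \<le> hit_time U L X \<omega> \<longleftrightarrow> no_hit U L n (\<lambda>i. X i \<omega>)"
  unfolding not_less[symmetric] hit_time_less_iff no_hit_def partial_sum_eq_heads[of X] by auto

lemma hit_time_eq_enatD:
  assumes "hit_time U L X \<omega> = enat k"
  shows "1 \<le> k" "no_hit U L k (\<lambda>i. X i \<omega>)"
    and "U k \<le> heads k (\<lambda>i. X i \<omega>) \<or> heads k (\<lambda>i. X i \<omega>) \<le> L k"
proof -
  show "1 \<le> k" using assms by (rule hit_time_pos)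
  show n: "no_hit U L k (\<lambda>i. X i \<omega>)" using assms hit_time_ge_iff[of k U L X \<omega>] by simp
  have "\<not> no_hit U L (Suc k) (\<lambda>i. X i \<omega>)" using assms hit_time_ge_iff[of "Suc k" U L X \<omega>] by simp
  with n show "U k \<le> heads k (\<lambda>i. X i \<omega>) \<or> heads k (\<lambda>i. X i \<omega>) \<le> L k"
    unfolding no_hit_def less_Suc_eq by (metis not_less)
qed

text \<open>For the converse, the hitting time \<open>k\<close> is at most the witness
  \<open>m\<close>; if \<open>k < m\<close>, the lower boundary is not met at \<open>k\<close>, so
  the upper one is.\<close>

lemma hit_time_upper_iff:
  "hit_time U L X \<omega> < enat n \<and> U (the_enat (hit_time U L X \<omega>)) \<le> partial_sum X (the_enat (hit_time U L X \<omega>)) \<omega>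
   \<longleftrightarrow> upper_hit U L n (\<lambda>i. X i \<omega>)" (is "?l \<longleftrightarrow> ?r")
proof
  assume l: ?l
  then obtain k where k: "hit_time U L X \<omega> = enat k" by (cases "hit_time U L X \<omega>") auto
  with l hit_time_eq_enatD[OF k] show ?r
    unfolding upper_hit_def no_hit_def partial_sum_eq_heads[of X] by auto
next
  assume ?r
  then obtain m where m: "1 \<le> m" "m < n" "U m \<le> heads m (\<lambda>i. X i \<omega>)"
    "\<And>j. 1 \<le> j \<Longrightarrow> j < m \<Longrightarrow> L j < heads j (\<lambda>i. X i \<omega>)"
    unfolding upper_hit_def by blast
  then have less: "hit_time U L X \<omega> < enat (Suc m)"
    unfolding hit_time_less_iff partial_sum_eq_heads[of X] by blast
  then obtain k where k: "hit_time U L X \<omega> = enat k" "k \<le> m" by (cases "hit_time U L X \<omega>") auto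
  have "U k \<le> heads k (\<lambda>i. X i \<omega>)"
    using hit_time_eq_enatD[OF k(1)] m k(2) by (cases "k = m") (auto simp: not_le[symmetric])
  with k m show ?l by (simp add: partial_sum_eq_heads[of X])
qed

lemma hit_time_lower_iff:
  "hit_time U L X \<omega> < enat n \<and> partial_sum X (the_enat (hit_time U L X \<omega>)) \<omega> \<le> L (the_enat (hit_time U L X \<omega>))
   \<longleftrightarrow> lower_hit U L n (\<lambda>i. X i \<omega>)" (is "?l \<longleftrightarrow> ?r")
proof
  assume l: ?l
  then obtain k where k: "hit_time U L X \<omega> = enat k" by (cases "hit_time U L X \<omega>") auto
  with l hit_time_eq_enatD[OF k] show ?r
    unfolding lower_hit_def no_hit_def partial_sum_eq_heads[of X] by auto
next
  assume ?r
  then obtain m where m: "1 \<le> m" "m < n" "heads m (\<lambda>i. X i \<omega>) \<le> L m"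
    "\<And>j. 1 \<le> j \<Longrightarrow> j < m \<Longrightarrow> heads j (\<lambda>i. X i \<omega>) < U j"
    unfolding lower_hit_def by blast
  then have less: "hit_time U L X \<omega> < enat (Suc m)"
    unfolding hit_time_less_iff partial_sum_eq_heads[of X] by blast
  then obtain k where k: "hit_time U L X \<omega> = enat k" "k \<le> m" by (cases "hit_time U L X \<omega>") auto
  have "heads k (\<lambda>i. X i \<omega>) \<le> L k"
    using hit_time_eq_enatD[OF k(1)] m k(2) by (cases "k = m") (auto simp: not_le[symmetric])
  with k m show ?l by (simp add: partial_sum_eq_heads[of X])
qed

lemma upper_spent_eq:
  "upper_spent M X U L n j =
     event_prob M X (\<lambda>f. no_hit U L n f \<and> j \<le> heads n f) + event_prob M X (upper_hit U L n)"
  unfolding upper_spent_def event_prob_def hit_time_ge_iff hit_time_upper_iff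
  by (simp only: partial_sum_eq_heads[of X])

lemma lower_spent_eq:
  "lower_spent M X U L n j =
     event_prob M X (\<lambda>f. no_hit U L n f \<and> heads n f \<le> j) + event_prob M X (lower_hit U L n)"
  unfolding lower_spent_def event_prob_def hit_time_ge_iff hit_time_lower_iff
  by (simp only: partial_sum_eq_heads[of X])

section \<open>The recursively constructed boundaries\<close>

text \<open>The integers are not well-ordered; shifting by the bound \<open>b\<close> moves the
  search to the naturals.\<close>

lemma int_LeastI_bounded:
  fixes Q :: "int \<Rightarrow> bool"
  assumes "Q j" "\<And>i. Q i \<Longrightarrow> b \<le> i"
  shows "Q (LEAST i. Q i)" and "(LEAST i. Q i) \<le> j"
proof -
  define m where "m = (LEAST k. Q (b + int k))"
  have ex: "Q (b + int (nat (i - b)))" if "Q i" for i using that assms(2)[OF that] by simp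
  have m: "Q (b + int m)" unfolding m_def by (rule LeastI[of _ "nat (j - b)"]) (rule ex[OF assms(1)])
  have le: "b + int m \<le> i" if "Q i" for i
    using Least_le[of "\<lambda>k. Q (b + int k)", OF ex[OF that]] assms(2)[OF that] by (simp add: m_def)
  have "(LEAST i. Q i) = b + int m" using m le by (rule Least_equality)
  then show "Q (LEAST i. Q i)" "(LEAST i. Q i) \<le> j" using m le[OF assms(1)] by simp_all
qed

lemma int_GreatestI_bounded:
  fixes Q :: "int \<Rightarrow> bool"
  assumes "Q j" "\<And>i. Q i \<Longrightarrow> i \<le> b"
  shows "Q (GREATEST i. Q i)"
proof -
  have b: "- b \<le> i" if "Q (- i)" for i using assms(2)[OF that] by simp
  have j: "Q (- (- j))" using assms(1) by simp
  note m = int_LeastI_bounded[of "\<lambda>i. Q (- i)", OF j b]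
  have "(GREATEST i. Q i) = - (LEAST i. Q (- i))"
  proof (rule Greatest_equality)
    show "Q (- (LEAST i. Q (- i)))" by (rule m)
    fix i assume "Q i"
    then have "Q (- (- i))" by simp
    from int_LeastI_bounded(2)[of "\<lambda>i. Q (- i)", OF this b] show "i \<le> - (LEAST i. Q (- i))" by simp
  qed
  then show ?thesis using m(1) by simp
qed

text \<open>Hoeffding's inequality; the upper tail is applied at \<alpha> to bound \<open>U\<close>,
  the lower tail at \<open>p > \<alpha>\<close> to show that paths stop.\<close>

lemma binomial_pmf_tails:
  assumes "p \<in> {0..1}" "0 < n" "0 \<le> \<delta>"
  shows "measure_pmf.prob (binomial_pmf n p) {k. p + \<delta> \<le> real k / real n} \<le> exp (-2 * real n * \<delta>\<^sup>2)"
    and "measure_pmf.prob (binomial_pmf n p) {k. real k / real n \<le> p - \<delta>} \<le> exp (-2 * real n * \<delta>\<^sup>2)"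
  using binomial_distribution.prob_ge'[of p n \<delta>] binomial_distribution.prob_le'[of p n \<delta>] assms
  by (simp_all add: binomial_distribution_def)

text \<open>\<open>M\<close> is the law at the threshold and alone fixes the boundaries; laws at
  other parameters enter as further measures \<open>N\<close> with the same
  \<open>X\<close>.\<close>

locale spending =
  fixes M :: "'a measure" and X :: "nat \<Rightarrow> 'a \<Rightarrow> bool" and \<alpha> :: real and e :: "nat \<Rightarrow> real"
  assumes process: "bernoulli_process M X \<alpha>"
    and \<alpha>: "0 < \<alpha>" "\<alpha> < 1"
    and e_mono: "mono_on {1..} e"
    and e_bounds: "\<And>n. 1 \<le> n \<Longrightarrow> 0 \<le> e n \<and> e n < 1 / 4"
begin

abbreviation U :: "nat \<Rightarrow> int" where "U \<equiv> upper_boundary M X e"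
abbreviation L :: "nat \<Rightarrow> int" where "L \<equiv> lower_boundary M X e"

lemma upper_hit_Suc_prob:
  "event_prob M X (upper_hit U L (Suc n)) \<le> upper_spent M X U L n (U n)"
  unfolding upper_spent_eq
  by (rule event_prob_subadditive[OF process determined_no_hit_heads determined_upper_hit])
    (rule upper_hit_Suc_cases)

lemma lower_hit_Suc_prob:
  "event_prob M X (lower_hit U L (Suc n)) \<le> lower_spent M X U L n (L n)"
  unfolding lower_spent_eq
  by (rule event_prob_subadditive[OF process determined_no_hit_heads determined_lower_hit])
    (rule lower_hit_Suc_cases)

lemma one_le_hit_probs:
  "1 \<le> event_prob M X (no_hit U L n) + event_prob M X (upper_hit U L n) + event_prob M X (lower_hit U L n)"
proof -
  interpret prob_space M using process by (simp add: bernoulli_process_def)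
  have d: "determined n (\<lambda>f. upper_hit U L n f \<or> lower_hit U L n f)"
    by (intro determined_disj determined_upper_hit determined_lower_hit)
  have "1 = event_prob M X (\<lambda>_. True)" by (simp add: event_prob_def prob_space)
  also have "\<dots> \<le> event_prob M X (no_hit U L n) + event_prob M X (\<lambda>f. upper_hit U L n f \<or> lower_hit U L n f)"
    by (rule event_prob_subadditive[OF process determined_no_hit d]) (rule hit_cases)
  also have "event_prob M X (\<lambda>f. upper_hit U L n f \<or> lower_hit U L n f)
      \<le> event_prob M X (upper_hit U L n) + event_prob M X (lower_hit U L n)"
    by (rule event_prob_subadditive[OF process determined_upper_hit determined_lower_hit])
  finally show ?thesis by simp
qed

text \<open>\<open>LEAST\<close> and \<open>GREATEST\<close> are meaningful only if candidates exist
  and are bounded. Candidates exist because the hits up to \<open>n\<close> cost at most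
  \<open>e n\<close>, hence at most \<open>e (Suc n)\<close>.\<close>

lemma boundary_step:
  assumes n: "1 \<le> n" and spent: "upper_spent M X U L n (U n) \<le> e n" "lower_spent M X U L n (L n) \<le> e n"
  shows "upper_spent M X U L (Suc n) (U (Suc n)) \<le> e (Suc n)"
    and "lower_spent M X U L (Suc n) (L (Suc n)) \<le> e (Suc n)"
    and "\<And>j. 1 \<le> j \<Longrightarrow> upper_spent M X U L (Suc n) j \<le> e (Suc n) \<Longrightarrow> U (Suc n) \<le> j"
proof -
  have ee: "e n \<le> e (Suc n)" using n by (intro mono_onD[OF e_mono]) auto
  have up: "event_prob M X (upper_hit U L (Suc n)) \<le> e (Suc n)"
    using upper_hit_Suc_prob[of n] spent ee by linarith
  have low: "event_prob M X (lower_hit U L (Suc n)) \<le> e (Suc n)"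
    using lower_hit_Suc_prob[of n] spent ee by linarith
  have n2: "2 \<le> Suc n" using n by simp
  let ?Q = "\<lambda>j. 1 \<le> j \<and> upper_spent M X U L (Suc n) j \<le> e (Suc n)"
  \<comment> \<open>\<open>Suc n\<close> tosses give at most \<open>n + 1\<close> heads, so this
    candidate adds nothing to the amount already spent; \<open>- 1\<close> does the same for the
    lower boundary.\<close>
  have "\<not> int n + 2 \<le> heads (Suc n) f" for f using heads_le[of "Suc n" f] by simp
  then have Q: "?Q (int n + 2)" unfolding upper_spent_eq using up by (simp add: event_prob_False)
  show "upper_spent M X U L (Suc n) (U (Suc n)) \<le> e (Suc n)"
    unfolding upper_boundary_rec[OF n2] using int_LeastI_bounded(1)[of ?Q, OF Q, of 1] by blast
  show "U (Suc n) \<le> j" if "1 \<le> j" "upper_spent M X U L (Suc n) j \<le> e (Suc n)" for j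
    unfolding upper_boundary_rec[OF n2] using int_LeastI_bounded(2)[of ?Q j 1] that by blast
  let ?R = "\<lambda>j. lower_spent M X U L (Suc n) j \<le> e (Suc n)"
  have "\<not> heads (Suc n) f \<le> - 1" for f using heads_nonneg[of "Suc n" f] by simp
  then have R: "?R (- 1)" unfolding lower_spent_eq using low by (simp add: event_prob_False)
  \<comment> \<open>Beyond \<open>Suc n\<close> the lower amount includes all of
    \<open>no_hit\<close>, so together with the upper hits it is at least \<open>1\<close>; this
    contradicts \<open>e (Suc n) < 1 / 4\<close>.\<close>
  have b: "j \<le> int (Suc n)" if "?R j" for j
  proof (rule ccontr)
    assume "\<not> j \<le> int (Suc n)"
    then have "heads (Suc n) f \<le> j" for f using heads_le[of "Suc n" f] by linarith
    then have "lower_spent M X U L (Suc n) j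
        = event_prob M X (no_hit U L (Suc n)) + event_prob M X (lower_hit U L (Suc n))"
      by (simp add: lower_spent_eq)
    with that one_le_hit_probs[of "Suc n"] up e_bounds[of "Suc n"] show False by simp
  qed
  show "lower_spent M X U L (Suc n) (L (Suc n)) \<le> e (Suc n)"
    unfolding lower_boundary_rec[OF n2] using R b by (rule int_GreatestI_bounded)
qed

lemma spent_le:
  assumes "1 \<le> n"
  shows "upper_spent M X U L n (U n) \<le> e n" "lower_spent M X U L n (L n) \<le> e n"
proof -
  have "upper_spent M X U L n (U n) \<le> e n \<and> lower_spent M X U L n (L n) \<le> e n"
    using assms
  proof (induction n rule: dec_induct)
    case base
    \<comment> \<open>The initial values \<open>2\<close> and \<open>- 1\<close> are out of reach of
      one toss, so nothing is spent at the first step.\<close>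
    have "\<not> 2 \<le> heads 1 f" "\<not> heads 1 f \<le> - 1" for f
      using heads_le[of 1 f] heads_nonneg[of 1 f] by simp_all
    then have "upper_spent M X U L 1 2 = 0" "lower_spent M X U L 1 (- 1) = 0"
      by (simp_all add: upper_spent_eq lower_spent_eq event_prob_False upper_hit_def lower_hit_def)
    then show ?case using e_bounds[of 1] by (simp add: boundary_1[unfolded One_nat_def])
  next
    case (step n)
    then show ?case using boundary_step[of n] by blast
  qed
  then show "upper_spent M X U L n (U n) \<le> e n" "lower_spent M X U L n (L n) \<le> e n" by simp_all
qed

lemma upper_boundary_le:
  assumes "2 \<le> n" "1 \<le> j" "upper_spent M X U L n j \<le> e n"
  shows "U n \<le> j"
proof -
  obtain m where m: "n = Suc m" "1 \<le> m" using assms(1) by (cases n) auto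
  show ?thesis using boundary_step(3)[OF m(2) spent_le[OF m(2)]] assms(2,3) m(1) by simp
qed

lemma hit_prob_le:
  assumes "1 \<le> n"
  shows "event_prob M X (upper_hit U L (Suc n)) \<le> e n"
    and "event_prob M X (lower_hit U L (Suc n)) \<le> e n"
  using upper_hit_Suc_prob[of n] lower_hit_Suc_prob[of n] spent_le[OF assms] by linarith+

section \<open>Separation of the boundaries by the mean\<close>

lemma crossing_prob_less_half:
  assumes "1 \<le> n"
  shows "event_prob M X (\<lambda>f. U n \<le> heads n f) < 1 / 2"
    and "event_prob M X (\<lambda>f. heads n f \<le> L n) < 1 / 2"
proof -
  have du: "determined n (\<lambda>f. (no_hit U L n f \<and> U n \<le> heads n f) \<or> upper_hit U L n f)"
    and dl: "determined n (\<lambda>f. (no_hit U L n f \<and> heads n f \<le> L n) \<or> lower_hit U L n f)"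
    by (intro determined_disj determined_no_hit_heads determined_upper_hit determined_lower_hit)+
  have u: "event_prob M X (\<lambda>f. (no_hit U L n f \<and> U n \<le> heads n f) \<or> upper_hit U L n f) \<le> e n"
    by (rule order_trans[OF _ spent_le(1)[OF assms]], unfold upper_spent_eq)
      (rule event_prob_subadditive[OF process determined_no_hit_heads determined_upper_hit])
  have l: "event_prob M X (\<lambda>f. (no_hit U L n f \<and> heads n f \<le> L n) \<or> lower_hit U L n f) \<le> e n"
    by (rule order_trans[OF _ spent_le(2)[OF assms]], unfold lower_spent_eq)
      (rule event_prob_subadditive[OF process determined_no_hit_heads determined_lower_hit])
  have "event_prob M X (upper_hit U L n) \<le> e n" "event_prob M X (lower_hit U L n) \<le> e n"
    using spent_le[OF assms] unfolding upper_spent_eq lower_spent_eq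
    by (smt (verit) event_prob_nonneg)+
  \<comment> \<open>Among the cases of \<open>hit_cases\<close>, only an earlier lower hit is not
    charged to the upper budget.\<close>
  moreover have "event_prob M X (\<lambda>f. U n \<le> heads n f)
      \<le> event_prob M X (\<lambda>f. (no_hit U L n f \<and> U n \<le> heads n f) \<or> upper_hit U L n f) + event_prob M X (lower_hit U L n)"
    by (rule event_prob_subadditive[OF process du determined_lower_hit]) (use hit_cases in blast)
  moreover have "event_prob M X (\<lambda>f. heads n f \<le> L n)
      \<le> event_prob M X (\<lambda>f. (no_hit U L n f \<and> heads n f \<le> L n) \<or> lower_hit U L n f) + event_prob M X (upper_hit U L n)"
    by (rule event_prob_subadditive[OF process dl determined_upper_hit]) (use hit_cases in blast)
  ultimately show "event_prob M X (\<lambda>f. U n \<le> heads n f) < 1 / 2"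
    "event_prob M X (\<lambda>f. heads n f \<le> L n) < 1 / 2"
    using u l e_bounds[OF assms] by linarith+
qed

text \<open>The mean \<open>real n * \<alpha>\<close> need not be an integer. Rounding it to
  \<open>k\<close>, down or up, moves the parameter to \<open>k / n\<close>, where the median is
  known; monotonicity in the parameter leads back to \<alpha>.\<close>

lemma heads_median:
  assumes "0 < n"
  shows "real_of_int j \<le> real n * \<alpha> \<Longrightarrow> 1 / 2 \<le> event_prob M X (\<lambda>f. j \<le> heads n f)"
    and "real n * \<alpha> \<le> real_of_int j \<Longrightarrow> 1 / 2 \<le> event_prob M X (\<lambda>f. heads n f \<le> j)"
proof -
  have \<alpha>01: "\<alpha> \<in> {0..1}" using \<alpha> by simp
  have n\<alpha>: "0 \<le> real n * \<alpha>" "real n * \<alpha> \<le> real n" using \<alpha> by (simp_all add: mult_left_le)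
  have ev: "event_prob M X (\<lambda>f. R (heads n f)) = measure_pmf.prob (coin_pmf n \<alpha>) {f. R (heads n f)}" for R
    by (simp add: event_prob_heads[OF process \<alpha>01] coin_pmf_heads[OF \<alpha>01])
  { assume j: "real_of_int j \<le> real n * \<alpha>"
    define k where "k = nat \<lfloor>real n * \<alpha>\<rfloor>"
    have k: "real k \<le> real n * \<alpha>" "j \<le> int k"
      using n\<alpha> j by (auto simp: k_def le_floor_iff)
    have kn: "k \<le> n" using k(1) n\<alpha>(2) by linarith
    have q: "0 \<le> real k / real n" "real k / real n \<le> \<alpha>"
      using k(1) assms by (auto simp: field_simps)
    have "1 / 2 \<le> measure_pmf.prob (binomial_pmf n (real k / real n)) {k..}"
      using assms kn by (rule binomial_pmf_median_ge)
    also have "\<dots> \<le> measure_pmf.prob (binomial_pmf n (real k / real n)) {i. j \<le> int i}"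
      by (rule measure_pmf.finite_measure_mono) (use k(2) in auto)
    also have "\<dots> = measure_pmf.prob (coin_pmf n (real k / real n)) {f. j \<le> heads n f}"
      by (rule coin_pmf_heads[symmetric]) (use q \<alpha> in auto)
    also have "\<dots> \<le> measure_pmf.prob (coin_pmf n \<alpha>) {f. j \<le> heads n f}"
      by (rule coin_pmf_prob_mono) (use q \<alpha> in \<open>auto intro: order_trans[OF _ heads_mono]\<close>)
    also have "\<dots> = event_prob M X (\<lambda>f. j \<le> heads n f)" by (rule ev[symmetric])
    finally show "1 / 2 \<le> event_prob M X (\<lambda>f. j \<le> heads n f)" . }
  { assume j: "real n * \<alpha> \<le> real_of_int j"
    define k where "k = nat \<lceil>real n * \<alpha>\<rceil>"
    have k0: "int k = \<lceil>real n * \<alpha>\<rceil>" using n\<alpha> by (simp add: k_def)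
    have k: "real n * \<alpha> \<le> real k" "int k \<le> j" "k \<le> n"
    proof -
      have "real n * \<alpha> \<le> of_int \<lceil>real n * \<alpha>\<rceil>" by simp
      then show "real n * \<alpha> \<le> real k" by (simp flip: k0)
      show "int k \<le> j" using j by (simp add: k0 ceiling_le_iff)
      have "\<lceil>real n * \<alpha>\<rceil> \<le> int n" using n\<alpha> by (simp add: ceiling_le_iff)
      then show "k \<le> n" using k0 by simp
    qed
    have q: "\<alpha> \<le> real k / real n" "real k / real n \<le> 1"
      using k assms by (auto simp: field_simps)
    have "1 / 2 \<le> measure_pmf.prob (binomial_pmf n (real k / real n)) {..k}"
      using assms k(3) by (rule binomial_pmf_median_le)
    also have "\<dots> \<le> measure_pmf.prob (binomial_pmf n (real k / real n)) {i. int i \<le> j}"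
      by (rule measure_pmf.finite_measure_mono) (use k(2) in auto)
    also have "\<dots> = measure_pmf.prob (coin_pmf n (real k / real n)) {f. heads n f \<le> j}"
      by (rule coin_pmf_heads[symmetric]) (use q \<alpha> in auto)
    also have "\<dots> \<le> measure_pmf.prob (coin_pmf n \<alpha>) {f. heads n f \<le> j}"
      by (rule coin_pmf_prob_antimono) (use q \<alpha> in \<open>auto intro: order_trans[OF heads_mono]\<close>)
    also have "\<dots> = event_prob M X (\<lambda>f. heads n f \<le> j)" by (rule ev[symmetric])
    finally show "1 / 2 \<le> event_prob M X (\<lambda>f. heads n f \<le> j)" . }
qed

text \<open>A boundary on the wrong side of the mean would be reached at time \<open>n\<close> with
  probability at least \<open>1 / 2\<close>.\<close>

lemma boundaries_separated:
  assumes "1 \<le> n"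
  shows "real n * \<alpha> < real_of_int (U n)" "real_of_int (L n) < real n * \<alpha>"
  using heads_median[of n] crossing_prob_less_half[OF assms] assms
  by (metis One_nat_def Suc_le_eq not_less)+

section \<open>Risk on either side of the threshold\<close>

lemma risk_below:
  assumes "bernoulli_process N X p" "0 \<le> p" "p \<le> \<alpha>" "\<And>n. 1 \<le> n \<Longrightarrow> e n \<le> \<epsilon>"
  shows "measure N {\<omega> \<in> space N. \<alpha> < p_hat \<alpha> U L X \<omega>} \<le> \<epsilon>"
proof -
  interpret prob_space N using assms(1) by (simp add: bernoulli_process_def)
  have bound: "event_prob N X (upper_hit U L n) \<le> \<epsilon>" for n
  proof -
    have "event_prob N X (upper_hit U L n) \<le> event_prob M X (upper_hit U L n)"
      by (rule event_prob_increasing[OF assms(1) process assms(2,3) _ determined_upper_hit])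
        (use \<alpha> in \<open>simp_all add: upper_hit_increasing\<close>)
    \<comment> \<open>The horizon is enlarged so that \<open>hit_prob_le\<close> applies at
      \<open>Suc n\<close>, which is positive even for \<open>n = 0\<close>.\<close>
    also have "\<dots> \<le> event_prob M X (upper_hit U L (Suc (Suc n)))"
      by (rule event_prob_mono[OF process determined_upper_hit]) (simp add: upper_hit_Suc)
    also have "\<dots> \<le> \<epsilon>" using hit_prob_le(1)[of "Suc n"] assms(4)[of "Suc n"] by simp
    finally show ?thesis .
  qed
  note E = event_prob_Ex[OF assms(1) determined_upper_hit _ bound]
  have "prob {\<omega> \<in> space N. \<alpha> < p_hat \<alpha> U L X \<omega>} \<le> prob {\<omega> \<in> space N. \<exists>n. upper_hit U L n (\<lambda>i. X i \<omega>)}"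
  proof (rule finite_measure_mono)
    show "{\<omega> \<in> space N. \<exists>n. upper_hit U L n (\<lambda>i. X i \<omega>)} \<in> events"
      by (rule E(1)) (simp add: upper_hit_Suc)
    show "{\<omega> \<in> space N. \<alpha> < p_hat \<alpha> U L X \<omega>} \<subseteq> {\<omega> \<in> space N. \<exists>n. upper_hit U L n (\<lambda>i. X i \<omega>)}"
    proof safe
      \<comment> \<open>The default value \<alpha> is not an error here, so stopping is finite; the
        stopped sum exceeds \<open>real k * \<alpha>\<close>, which rules out
        \<open>L k\<close>.\<close>
      fix \<omega> assume \<omega>: "\<alpha> < p_hat \<alpha> U L X \<omega>"
      then obtain k where k: "hit_time U L X \<omega> = enat k" "\<alpha> < real_of_int (partial_sum X k \<omega>) / real k"
        by (auto simp: p_hat_def split: enat.splits)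
      note h = hit_time_eq_enatD[OF k(1)]
      have "real k * \<alpha> < real_of_int (partial_sum X k \<omega>)" using k(2) h(1) by (simp add: field_simps)
      with boundaries_separated(2)[OF h(1)] have "\<not> partial_sum X k \<omega> \<le> L k" by linarith
      with h(3) have "U k \<le> partial_sum X k \<omega>" by (simp add: partial_sum_eq_heads[of X])
      with k(1) hit_time_upper_iff[of U L X \<omega> "Suc k"]
      show "\<exists>n. upper_hit U L n (\<lambda>i. X i \<omega>)" by auto
    qed
  qed
  also have "\<dots> \<le> \<epsilon>" by (rule E(2)) (simp add: upper_hit_Suc)
  finally show ?thesis .
qed

text \<open>At this candidate the new crossings cost at most the increment
  \<open>e n - e (n - 1)\<close>, and the earlier hits at most \<open>e (n - 1)\<close>.\<close>

lemma upper_boundary_eventually_le: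
  assumes "0 < \<delta>" and "\<forall>\<^sub>F n in sequentially. e (n - 1) < e n"
    and "(\<lambda>n. ln (e n - e (n - 1))) \<in> o(\<lambda>n. real n)"
  shows "\<forall>\<^sub>F n in sequentially. U n \<le> \<lceil>real n * (\<alpha> + \<delta>)\<rceil>"
proof -
  have \<alpha>01: "\<alpha> \<in> {0..1}" using \<alpha> by simp
  \<comment> \<open>The little-o constant is chosen as the rate in Hoeffding's exponent.\<close>
  have "\<forall>\<^sub>F n in sequentially. norm (ln (e n - e (n - 1))) \<le> 2 * \<delta>\<^sup>2 * norm (real n)"
    using assms(3) by (rule landau_o.smallD) (use assms(1) in simp)
  with assms(2) eventually_ge_at_top[of 2] show ?thesis
  proof eventually_elim
    case (elim n)
    define j where "j = \<lceil>real n * (\<alpha> + \<delta>)\<rceil>"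
    have jge: "real n * (\<alpha> + \<delta>) \<le> real_of_int j" by (simp add: j_def)
    have "0 < real n * (\<alpha> + \<delta>)" using elim assms(1) \<alpha> by simp
    with jge have j1: "1 \<le> j" by linarith
    have "event_prob M X (\<lambda>f. no_hit U L n f \<and> j \<le> heads n f) \<le> event_prob M X (\<lambda>f. j \<le> heads n f)"
      by (rule event_prob_mono[OF process determined_heads, where n = n]) simp_all
    also have "\<dots> = measure_pmf.prob (binomial_pmf n \<alpha>) {k. j \<le> int k}"
      by (rule event_prob_heads[OF process \<alpha>01])
    also have "\<dots> \<le> measure_pmf.prob (binomial_pmf n \<alpha>) {k. real k / real n \<ge> \<alpha> + \<delta>}"
    proof (rule measure_pmf.finite_measure_mono)
      show "{k. j \<le> int k} \<subseteq> {k. real k / real n \<ge> \<alpha> + \<delta>}"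
      proof safe
        fix k assume "j \<le> int k"
        then have "real n * (\<alpha> + \<delta>) \<le> real k" using jge by linarith
        then show "\<alpha> + \<delta> \<le> real k / real n" using elim by (simp add: field_simps)
      qed
    qed simp
    also have "\<dots> \<le> exp (-2 * real n * \<delta>\<^sup>2)" by (rule binomial_pmf_tails[OF \<alpha>01]) (use elim assms(1) in auto)
    also have "exp (-2 * real n * \<delta>\<^sup>2) \<le> exp (ln (e n - e (n - 1)))"
    proof -
      have "- ln (e n - e (n - 1)) \<le> 2 * \<delta>\<^sup>2 * real n"
        using elim(3) by (simp only: real_norm_def abs_le_iff abs_of_nat)
      moreover have "2 * \<delta>\<^sup>2 * real n = - (-2 * real n * \<delta>\<^sup>2)" by simp
      ultimately show ?thesis unfolding exp_le_cancel_iff by linarith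
    qed
    \<comment> \<open>Uses that the increment is positive here, since \<open>ln\<close> is inverted
      by \<open>exp\<close> only on positive numbers.\<close>
    also have "\<dots> = e n - e (n - 1)" using elim by simp
    finally have "event_prob M X (\<lambda>f. no_hit U L n f \<and> j \<le> heads n f) \<le> e n - e (n - 1)" .
    moreover have "event_prob M X (upper_hit U L n) \<le> e (n - 1)"
      using hit_prob_le(1)[of "n - 1"] elim by simp
    ultimately have "upper_spent M X U L n j \<le> e n" unfolding upper_spent_eq by linarith
    then show ?case using upper_boundary_le[of n j] elim j1 by (simp add: j_def)
  qed
qed

text \<open>A path that never stops is below \<open>U n\<close> at every \<open>n\<close>, hence
  eventually below its own mean by a linear margin, an event of exponentially small
  probability.\<close>

lemma no_hit_forever_null:
  assumes "bernoulli_process N X p" "\<alpha> < p" "p \<le> 1" "\<forall>\<^sub>F n in sequentially. e (n - 1) < e n"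
    and "(\<lambda>n. ln (e n - e (n - 1))) \<in> o(\<lambda>n. real n)"
  shows "measure N {\<omega> \<in> space N. hit_time U L X \<omega> = \<infinity>} = 0"
proof -
  interpret N: prob_space N using assms(1) by (simp add: bernoulli_process_def)
  \<comment> \<open>Half the gap, so that \<open>\<alpha> + \<delta> = p - \<delta>\<close>.\<close>
  define \<delta> where "\<delta> = (p - \<alpha>) / 2"
  have \<delta>: "0 < \<delta>" "p = \<alpha> + 2 * \<delta>" using assms(2) by (simp_all add: \<delta>_def field_simps)
  have p01: "p \<in> {0..1}" using assms(2,3) \<alpha> by simp
  have "\<forall>\<^sub>F n in sequentially. measure N {\<omega> \<in> space N. hit_time U L X \<omega> = \<infinity>} \<le> exp (-2 * real n * \<delta>\<^sup>2)"
    using upper_boundary_eventually_le[OF \<delta>(1) assms(4,5)] eventually_ge_at_top[of 1]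
  proof eventually_elim
    case (elim n)
    have "measure N {\<omega> \<in> space N. hit_time U L X \<omega> = \<infinity>} \<le> event_prob N X (\<lambda>f. heads n f < U n)"
      unfolding event_prob_def
    proof (rule N.finite_measure_mono)
      show "{\<omega> \<in> space N. heads n (\<lambda>i. X i \<omega>) < U n} \<in> N.events"
        by (rule bernoulli_process_event(1)[OF assms(1) determined_heads, where n = n]) simp
      show "{\<omega> \<in> space N. hit_time U L X \<omega> = \<infinity>} \<subseteq> {\<omega> \<in> space N. heads n (\<lambda>i. X i \<omega>) < U n}"
      proof safe
        fix \<omega> assume "hit_time U L X \<omega> = \<infinity>"
        then have "no_hit U L (Suc n) (\<lambda>i. X i \<omega>)" by (simp flip: hit_time_ge_iff)
        then show "heads n (\<lambda>i. X i \<omega>) < U n" using elim by (simp add: no_hit_def)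
      qed
    qed
    also have "\<dots> = measure_pmf.prob (binomial_pmf n p) {k. int k < U n}"
      by (rule event_prob_heads[OF assms(1) p01])
    also have "\<dots> \<le> measure_pmf.prob (binomial_pmf n p) {k. real k / real n \<le> p - \<delta>}"
    proof (rule measure_pmf.finite_measure_mono)
      show "{k. int k < U n} \<subseteq> {k. real k / real n \<le> p - \<delta>}"
      proof safe
        fix k assume "int k < U n"
        \<comment> \<open>An integer strictly below a ceiling is below the number itself.\<close>
        then have "real k \<le> real n * (\<alpha> + \<delta>)" using elim by linarith
        then show "real k / real n \<le> p - \<delta>" using elim \<delta>(2) by (simp add: field_simps)
      qed
    qed simp
    also have "\<dots> \<le> exp (-2 * real n * \<delta>\<^sup>2)" by (rule binomial_pmf_tails[OF p01]) (use elim \<delta> in auto)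
    finally show ?case .
  qed
  moreover have "(\<lambda>n. exp (-2 * real n * \<delta>\<^sup>2)) \<longlonglongrightarrow> 0"
  proof -
    have "(\<lambda>n. exp (-2 * \<delta>\<^sup>2) ^ n) \<longlonglongrightarrow> 0"
      using \<delta>(1) by (intro LIMSEQ_power_zero) simp
    then show ?thesis by (simp add: exp_of_nat_mult[symmetric] mult_ac)
  qed
  ultimately have "measure N {\<omega> \<in> space N. hit_time U L X \<omega> = \<infinity>} \<le> 0"
    by (intro tendsto_lowerbound[where F = sequentially]) simp_all
  then show ?thesis using measure_nonneg[of N] by (rule antisym)
qed

text \<open>Above the threshold the default value \<alpha> counts as an error, so never stopping
  must be added to the lower hits.\<close>

lemma risk_above:
  assumes "bernoulli_process N X p" "\<alpha> < p" "p \<le> 1" "\<And>n. 1 \<le> n \<Longrightarrow> e n \<le> \<epsilon>"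
    and "\<forall>\<^sub>F n in sequentially. e (n - 1) < e n"
    and "(\<lambda>n. ln (e n - e (n - 1))) \<in> o(\<lambda>n. real n)"
  shows "measure N {\<omega> \<in> space N. p_hat \<alpha> U L X \<omega> \<le> \<alpha>} \<le> \<epsilon>"
proof -
  interpret prob_space N using assms(1) by (simp add: bernoulli_process_def)
  have bound: "event_prob N X (lower_hit U L n) \<le> \<epsilon>" for n
  proof -
    have "event_prob N X (lower_hit U L n) \<le> event_prob M X (lower_hit U L n)"
      by (rule event_prob_decreasing[OF process assms(1) _ _ assms(3) determined_lower_hit])
        (use \<alpha> assms(2) in \<open>simp_all add: lower_hit_decreasing\<close>)
    also have "\<dots> \<le> event_prob M X (lower_hit U L (Suc (Suc n)))"
      by (rule event_prob_mono[OF process determined_lower_hit]) (simp add: lower_hit_Suc)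
    also have "\<dots> \<le> \<epsilon>" using hit_prob_le(2)[of "Suc n"] assms(4)[of "Suc n"] by simp
    finally show ?thesis .
  qed
  note E = event_prob_Ex[OF assms(1) determined_lower_hit _ bound]
  let ?I = "{\<omega> \<in> space N. hit_time U L X \<omega> = \<infinity>}"
  let ?B = "{\<omega> \<in> space N. \<exists>n. lower_hit U L n (\<lambda>i. X i \<omega>)}"
  have B: "?B \<in> events" by (rule E(1)) (simp add: lower_hit_Suc)
  \<comment> \<open>Never stopping is a countable intersection of finite-horizon events, hence
    measurable.\<close>
  have "?I = (\<Inter>n. {\<omega> \<in> space N. no_hit U L n (\<lambda>i. X i \<omega>)})"
  proof -
    have "hit_time U L X \<omega> = \<infinity> \<longleftrightarrow> (\<forall>n. enat n \<le> hit_time U L X \<omega>)" for \<omega>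
      by (cases "hit_time U L X \<omega>") (auto simp: not_le intro!: exI[of _ "Suc _"])
    then show ?thesis by (auto simp: hit_time_ge_iff)
  qed
  moreover have "{\<omega> \<in> space N. no_hit U L n (\<lambda>i. X i \<omega>)} \<in> events" for n
    by (rule bernoulli_process_event(1)[OF assms(1) determined_no_hit])
  ultimately have I: "?I \<in> events" by (simp add: sets.countable_INT'')
  have "prob {\<omega> \<in> space N. p_hat \<alpha> U L X \<omega> \<le> \<alpha>} \<le> prob (?I \<union> ?B)"
  proof (rule finite_measure_mono)
    show "?I \<union> ?B \<in> events" using I B by (rule sets.Un)
    show "{\<omega> \<in> space N. p_hat \<alpha> U L X \<omega> \<le> \<alpha>} \<subseteq> ?I \<union> ?B"
    proof
      fix \<omega> assume \<omega>: "\<omega> \<in> {\<omega> \<in> space N. p_hat \<alpha> U L X \<omega> \<le> \<alpha>}"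
      show "\<omega> \<in> ?I \<union> ?B"
      proof (cases "hit_time U L X \<omega>")
        case (enat k)
        note h = hit_time_eq_enatD[OF enat]
        have "real_of_int (partial_sum X k \<omega>) \<le> real k * \<alpha>"
          using \<omega> enat h(1) by (simp add: p_hat_def field_simps)
        with boundaries_separated(1)[OF h(1)] have "\<not> U k \<le> partial_sum X k \<omega>" by linarith
        with h(3) have "partial_sum X k \<omega> \<le> L k" by (simp add: partial_sum_eq_heads[of X])
        with enat hit_time_lower_iff[of U L X \<omega> "Suc k"] have "lower_hit U L (Suc k) (\<lambda>i. X i \<omega>)" by simp
        then show ?thesis using \<omega> by auto
      qed (use \<omega> in simp)
    qed
  qed
  also have "\<dots> \<le> prob ?I + prob ?B" using I B by (rule measure_Un_le)
  also have "prob ?I = 0" using assms(1-3,5,6) by (rule no_hit_forever_null)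
  also have "prob ?B \<le> \<epsilon>" by (rule E(2)) (simp add: lower_hit_Suc)
  finally show ?thesis by simp
qed

end

theorem theorem2:
  fixes P :: "real \<Rightarrow> 'a measure" and X :: "nat \<Rightarrow> 'a \<Rightarrow> bool"
    and \<alpha> \<epsilon> :: real and e :: "nat \<Rightarrow> real"
  assumes "\<And>p. p \<in> {0..1} \<Longrightarrow> bernoulli_process (P p) X p"
    and "0 < \<alpha>" and "\<alpha> < 1"
    and "\<epsilon> > 0"
    and "mono_on {1..} e"
    and "\<And>n. n \<ge> 1 \<Longrightarrow> 0 \<le> e n \<and> e n < \<epsilon>"
    and "e \<longlonglongrightarrow> \<epsilon>"
    and "\<epsilon> \<le> 1 / 4"
    and "\<forall>\<^sub>F n in sequentially. e (n - 1) < e n"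
    and "(\<lambda>n. ln (e n - e (n - 1))) \<in> o(\<lambda>n. real n)"
  shows "(SUP p\<in>{0..1}. resampling_risk P \<alpha>
           (p_hat \<alpha> (upper_boundary (P \<alpha>) X e) (lower_boundary (P \<alpha>) X e) X) p) \<le> \<epsilon>"
proof (rule cSUP_least)
  interpret spending "P \<alpha>" X \<alpha> e
  proof
    show "bernoulli_process (P \<alpha>) X \<alpha>" using assms(1-3) by simp
    show "0 \<le> e n \<and> e n < 1 / 4" if "1 \<le> n" for n using assms(6)[OF that] assms(8) by linarith
  qed (use assms in auto)
  have e: "e n \<le> \<epsilon>" if "1 \<le> n" for n using assms(6)[OF that] by simp
  fix p :: real assume p: "p \<in> {0..1}"
  show "resampling_risk P \<alpha>
      (p_hat \<alpha> (upper_boundary (P \<alpha>) X e) (lower_boundary (P \<alpha>) X e) X) p \<le> \<epsilon>"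
  proof (cases "p \<le> \<alpha>")
    case True
    then show ?thesis
      using risk_below[OF assms(1)[OF p] _ True e] p by (simp add: resampling_risk_def)
  next
    case False
    then show ?thesis
      using risk_above[OF assms(1)[OF p] _ _ e assms(9,10)] p
      by (simp add: resampling_risk_def)
  qed
qed simp

end
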